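(* For every $k\in\mathbb{T}$, the one-period operation cost $\widetilde C(k,x)$ satisfies $$\widetilde C(k,0)=\int_k^{k+1}e^{-\delta(u-k)}[c_2(u)-c_3(u)]\lambda(u)\,du$$ when $x=0$, and $$\begin{aligned}\widetilde C(k,x)=\;&c_1\sum_{n=0}^{x-1}\sum_{i=0}^{n}\int_k^{k+1}e^{-\delta(u-k)}e^{-(\Lambda(u)-\Lambda(k))}\frac{(\Lambda(u)-\Lambda(k))^i}{i!}\,du\\&+\int_k^{k+1}e^{-\delta(u-k)}[c_2(u)-c_3(u)]\lambda(u)\,du\\&-\sum_{i=0}^{x}\int_k^{k+1}e^{-\delta(u-k)}c_2(u)\lambda(u)e^{-(\Lambda(u)-\Lambda(k))}\frac{(\Lambda(u)-\Lambda(k))^i}{i!}\,du\end{aligned}$$ when $x\ge1$.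
   Context: $T\in[0,\infty)$ is the time horizon, $\mathbb{T}=\{0,1,\dots,T\}$, $\mathbb{Z}_+=\{0,1,\dots\}$. $N=(N_t)_{t\in[0,T]}$ is a non-homogeneous Poisson process with intensity function $\lambda:[0,T]\to\mathbb{R}_+$, which is right-continuous with left limits, piecewise smooth (differentiable except at finitely many points), and non-increasing; $\Lambda(t)=\int_0^t\lambda(u)\,du$. Constants $c_1\in\mathbb{R}_+$, $\delta\in[0,1]$. Functions $c_2,c_3:[0,T]\to\mathbb{R}_+$ with $c_2(u)\ge c_3(u)$ for every $u\in[0,T]$. For $k\in\mathbb{T}$ and $x\in\mathbb{Z}_+$, $\sigma^k_x:=\inf\{u>k:N_u-N_k\ge x\}$, $a\wedge b:=\min\{a,b\}$, $(a)^+:=\max\{0,a\}$, and $$\widetilde C(k,x):=c_1\mathbb{E}\Big[\int_k^{k+1}e^{-\delta(u-k)}(x-(N_u-N_k))^+du\Big]+\mathbb{E}\Big[\int_k^{k+1}e^{-\delta(u-k)}[c_2(u)-c_3(u)]\,dN_u\Big]-\mathbb{E}\Big[\int_k^{(k+1)\wedge\sigma^k_x}e^{-\delta(u-k)}c_2(u)\,dN_u\Big].$$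
   Formalization: The last sum runs to x-1, not x (the printed formula fails for λ=c_2=1, c_1=δ=c_3=0, k=0, x=1); λ, N, c_2, c_3 are given on [0,T+1] so that k=T makes sense; c_2, c_3 are assumed Borel and c_2λ integrable there so that the cost is well defined. *)

theory Defs
  imports "HOL-Probability.Probability"
begin

text \<open>
  Functions of time are total functions on \<open>real\<close>; only their values on a horizon \<open>[0, S]\<close> matter.
  The horizon \<open>S\<close> is a parameter because the period \<open>[k, k + 1]\<close> with \<open>k\<close> the last decision epoch
  reaches up to \<open>T + 1\<close>: the model on \<open>[0, T]\<close> has to be continued up to \<open>S = T + 1\<close> (for instance,
  with intensity \<open>0\<close> and a constant path after \<open>T\<close>).
\<close>

definition intensity_function :: "real \<Rightarrow> (real \<Rightarrow> real) \<Rightarrow> bool" where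
  "intensity_function S lam \<longleftrightarrow>
     (\<forall>t\<in>{0..S}. 0 \<le> lam t) \<and>
     (\<forall>t\<in>{0..<S}. (lam \<longlongrightarrow> lam t) (at_right t)) \<and>
     (\<forall>t\<in>{0<..S}. \<exists>l. (lam \<longlongrightarrow> l) (at_left t)) \<and>
     (\<exists>F. finite F \<and> (\<forall>t\<in>{0..S} - F. lam differentiable (at t within {0..S}))) \<and>
     (\<forall>s\<in>{0..S}. \<forall>t\<in>{0..S}. s \<le> t \<longrightarrow> lam t \<le> lam s)"

definition cumulative_intensity :: "(real \<Rightarrow> real) \<Rightarrow> real \<Rightarrow> real" where
  "cumulative_intensity lam t = (LBINT u:{0..t}. lam u)"

text \<open>
  The Poisson weights are written out because \<^const>\<open>poisson_pmf\<close> requires a positive rate,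
  whereas the increment of \<open>\<Lambda>\<close> may vanish. The natural subtractions do not truncate, since
  paths are nondecreasing.
\<close>

locale nonhomogeneous_poisson_process = prob_space M
  for M :: "'a measure" +
  fixes S :: real and lam :: "real \<Rightarrow> real" and N :: "real \<Rightarrow> 'a \<Rightarrow> nat"
  assumes measurable_N: "t \<in> {0..S} \<Longrightarrow> random_variable (count_space UNIV) (N t)"
    and start_zero: "\<omega> \<in> space M \<Longrightarrow> N 0 \<omega> = 0"
    and paths_mono: "\<omega> \<in> space M \<Longrightarrow> 0 \<le> s \<Longrightarrow> s \<le> t \<Longrightarrow> t \<le> S \<Longrightarrow> N s \<omega> \<le> N t \<omega>"
    and paths_right_continuous:
      "\<omega> \<in> space M \<Longrightarrow> t \<in> {0..<S} \<Longrightarrow> ((\<lambda>u. real (N u \<omega>)) \<longlongrightarrow> real (N t \<omega>)) (at_right t)"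
    and independent_increments:
      "(\<And>i. i \<le> n \<Longrightarrow> \<tau> i \<in> {0..S}) \<Longrightarrow> (\<And>i. i < n \<Longrightarrow> \<tau> i \<le> \<tau> (Suc i)) \<Longrightarrow>
        indep_vars (\<lambda>_. count_space UNIV) (\<lambda>i \<omega>. N (\<tau> (Suc i)) \<omega> - N (\<tau> i) \<omega>) {..<n::nat}"
    and poisson_increments:
      "0 \<le> s \<Longrightarrow> s \<le> t \<Longrightarrow> t \<le> S \<Longrightarrow>
        prob {\<omega> \<in> space M. N t \<omega> - N s \<omega> = m} =
          exp (- (cumulative_intensity lam t - cumulative_intensity lam s)) *
          (cumulative_intensity lam t - cumulative_intensity lam s) ^ m / fact m"

text \<open>
  \<open>jump_measure S N \<omega>\<close> is the Lebesgue-Stieltjes measure \<open>dN\<^sub>u(\<omega>)\<close>. The time argument is clamped to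
  \<open>[0, S]\<close> because \<^const>\<open>interval_measure\<close> expects a nondecreasing right-continuous function on the
  whole line. Pathwise integrals \<open>\<integral>\<^sub>a\<^sup>b f(u) dN\<^sub>u\<close> are taken over \<open>(a, b]\<close>.
\<close>

definition jump_measure :: "real \<Rightarrow> (real \<Rightarrow> 'a \<Rightarrow> nat) \<Rightarrow> 'a \<Rightarrow> real measure" where
  "jump_measure S N \<omega> = interval_measure (\<lambda>u. real (N (max 0 (min S u)) \<omega>))"

definition jump_integral ::
  "real \<Rightarrow> (real \<Rightarrow> 'a \<Rightarrow> nat) \<Rightarrow> 'a \<Rightarrow> real \<Rightarrow> real \<Rightarrow> (real \<Rightarrow> real) \<Rightarrow> real" where
  "jump_integral S N \<omega> a b f = (LINT u:{a<..b}|jump_measure S N \<omega>. f u)"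

text \<open>\<open>\<sigma>\<^sup>k\<^sub>x\<close>; it is extended-real valued, with value \<open>\<infinity>\<close> if the level is not reached by time \<open>S\<close>.\<close>

definition stockout_time ::
  "real \<Rightarrow> (real \<Rightarrow> 'a \<Rightarrow> nat) \<Rightarrow> 'a \<Rightarrow> nat \<Rightarrow> nat \<Rightarrow> ereal" where
  "stockout_time S N \<omega> k x = Inf (ereal ` {u. real k < u \<and> u \<le> S \<and> x \<le> N u \<omega> - N (real k) \<omega>})"

text \<open>
  The last integral runs over \<open>(k, (k + 1) \<and> \<sigma>\<^sup>k\<^sub>x]\<close>, so a jump at \<open>u\<close> contributes iff
  \<open>N\<^bsub>u-\<^esub> - N\<^sub>k < x\<close>. Its expectation therefore involves the Poisson weights of \<open>0, \<dots>, x - 1\<close> only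
  (none if \<open>x = 0\<close>); a formula with upper summation index \<open>x\<close> in place of \<open>x - 1\<close> does not match
  this definition.
\<close>

definition operation_cost ::
  "'a measure \<Rightarrow> real \<Rightarrow> (real \<Rightarrow> 'a \<Rightarrow> nat) \<Rightarrow> real \<Rightarrow> real \<Rightarrow> (real \<Rightarrow> real) \<Rightarrow> (real \<Rightarrow> real)
    \<Rightarrow> nat \<Rightarrow> nat \<Rightarrow> real" where
  "operation_cost M S N c1 \<delta> c2 c3 k x =
     c1 * (LINT \<omega>|M. (LBINT u:{real k..real k + 1}.
             exp (- \<delta> * (u - real k)) * max 0 (real x - (real (N u \<omega>) - real (N (real k) \<omega>)))))
   + (LINT \<omega>|M. jump_integral S N \<omega> (real k) (real k + 1)
             (\<lambda>u. exp (- \<delta> * (u - real k)) * (c2 u - c3 u)))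
   - (LINT \<omega>|M. jump_integral S N \<omega> (real k)
             (real_of_ereal (min (ereal (real k + 1)) (stockout_time S N \<omega> k x)))
             (\<lambda>u. exp (- \<delta> * (u - real k)) * c2 u))"

end

theory Submission
  imports Defs
begin

text \<open>
  The two stochastic integrals reduce to Campbell's formula
  \<open>E \<integral> f(u) 1[u \<le> \<sigma>] dN\<^sub>u = \<integral> f(u) \<lambda>(u) P(N\<^sub>u - N\<^sub>k < x) du\<close>, where the indicator is absent for the
  arrivals. Both sides are integrals of \<open>f\<close> against finite measures, so it suffices to compare them on
  half-lines, that is, to compute the mean of the stopped increment \<open>N\<close> at \<open>min t \<sigma>\<close> minus \<open>N\<^sub>k\<close>. This
  increment is the limit of the left sums, over consecutive grid points \<open>t\<^sub>i, t'\<close>, of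
  \<open>1[N(t\<^sub>i) - N\<^sub>k < x] (N(t') - N(t\<^sub>i))\<close>: each sum telescopes to the first grid point at which the
  level \<open>x\<close> is reached, and the paths are right-continuous. By independence of increments the means
  of these sums are left Riemann-Stieltjes sums of \<open>P(N\<^sub>u - N\<^sub>k < x)\<close> with respect to \<open>\<Lambda>\<close>. The jumps
  are never needed to have size one. The holding cost is Fubini together with
  \<open>max 0 (x - m) = #{n < x. m \<le> n}\<close>.
\<close>

section \<open>Random measures and their mean measure\<close>

text \<open>Half-lines are stable under intersection and generate the Borel sets, so Dynkin's
  theorem carries measurability and the mean identity from half-lines to all Borel sets; monotone
  approximation then carries both to nonnegative functions. Thus \<open>\<mu>\<close> is the mean
  measure of the random measure \<open>K\<close>.\<close>

lemma kernel_nn_integral: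
  fixes K :: "'a \<Rightarrow> real measure"
  assumes sets_K: "\<And>\<omega>. \<omega> \<in> space M \<Longrightarrow> sets (K \<omega>) = sets borel"
    and fin_K: "\<And>\<omega>. \<omega> \<in> space M \<Longrightarrow> finite_measure (K \<omega>)"
    and sets_\<mu>: "sets \<mu> = sets borel"
    and fin_\<mu>: "finite_measure \<mu>"
    and meas: "\<And>t. (\<lambda>\<omega>. emeasure (K \<omega>) {..t}) \<in> borel_measurable M"
    and eq: "\<And>t. (\<integral>\<^sup>+\<omega>. emeasure (K \<omega>) {..t} \<partial>M) = emeasure \<mu> {..t}"
    and f: "f \<in> borel_measurable borel"
  shows "(\<lambda>\<omega>. \<integral>\<^sup>+u. f u \<partial>K \<omega>) \<in> borel_measurable M"
    and "(\<integral>\<^sup>+\<omega>. \<integral>\<^sup>+u. f u \<partial>K \<omega> \<partial>M) = (\<integral>\<^sup>+u. f u \<partial>\<mu>)"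
proof -
  have space_K: "space (K \<omega>) = UNIV" if "\<omega> \<in> space M" for \<omega>
    using sets_eq_imp_space_eq[OF sets_K[OF that]] by simp
  have space_\<mu>: "space \<mu> = UNIV"
    using sets_eq_imp_space_eq[OF sets_\<mu>] by simp
  have fin: "emeasure \<mu> A < \<infinity>" for A
    using finite_measure.emeasure_finite[OF fin_\<mu>, of A] by (simp add: less_top)
  \<comment> \<open>Measurability belongs to the induction property because the complement and union
    cases exchange the integral over \<open>M\<close> with a difference or a series.\<close>
  define P where "P = (\<lambda>A. (\<lambda>\<omega>. emeasure (K \<omega>) A) \<in> borel_measurable M \<and>
    (\<integral>\<^sup>+\<omega>. emeasure (K \<omega>) A \<partial>M) = emeasure \<mu> A)"
  have U: "(\<Union>n::nat. {..real n}) = UNIV"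
    using real_arch_simple by auto
  have U': "\<Union> (range (atMost :: real \<Rightarrow> real set)) = UNIV"
    by auto
  have lim_UNIV: "(SUP n::nat. emeasure \<nu> {..real n}) = emeasure \<nu> UNIV" if "sets \<nu> = sets borel" for \<nu> :: "real measure"
    by (subst SUP_emeasure_incseq) (auto simp: that U incseq_def)
  have K_UNIV: "(SUP n::nat. emeasure (K \<omega>) {..real n}) = emeasure (K \<omega>) UNIV" if "\<omega> \<in> space M" for \<omega>
    by (rule lim_UNIV) (simp add: sets_K that)
  \<comment> \<open>The whole line is not a half-line, so it is reached as the increasing limit of
    \<open>{..real n}\<close>; the complement case subtracts from it.\<close>
  have P_UNIV: "P UNIV"
    unfolding P_def
  proof
    have "(\<lambda>\<omega>. SUP n::nat. emeasure (K \<omega>) {..real n}) \<in> borel_measurable M"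
      using meas by measurable
    then show "(\<lambda>\<omega>. emeasure (K \<omega>) UNIV) \<in> borel_measurable M"
      by (subst measurable_cong[OF K_UNIV[symmetric]])
    have "(\<integral>\<^sup>+\<omega>. emeasure (K \<omega>) UNIV \<partial>M) = (\<integral>\<^sup>+\<omega>. (SUP n::nat. emeasure (K \<omega>) {..real n}) \<partial>M)"
      by (intro nn_integral_cong) (simp add: K_UNIV)
    also have "\<dots> = (SUP n::nat. \<integral>\<^sup>+\<omega>. emeasure (K \<omega>) {..real n} \<partial>M)"
    proof (rule nn_integral_monotone_convergence_SUP_AE)
      show "AE \<omega> in M. emeasure (K \<omega>) {..real n} \<le> emeasure (K \<omega>) {..real (Suc n)}" for n
        by (auto intro!: emeasure_mono simp: sets_K)
    qed (rule meas)
    also have "\<dots> = emeasure \<mu> UNIV"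
      by (simp only: eq lim_UNIV[OF sets_\<mu>])
    finally show "(\<integral>\<^sup>+\<omega>. emeasure (K \<omega>) UNIV \<partial>M) = emeasure \<mu> UNIV" .
  qed
  have borel: "sets (borel::real measure) = sigma_sets UNIV (range atMost)"
    by (simp add: borel_eq_atMost)
  have Int_stable_atMost: "Int_stable (range (atMost :: real \<Rightarrow> real set))"
    by (auto simp: Int_stable_def)
  have P_sets: "P A" if "A \<in> sets borel" for A
    using Int_stable_atMost subset_Pow_Union[of "range (atMost :: real \<Rightarrow> real set)", unfolded U'] that[unfolded borel]
  proof (induction rule: sigma_sets_induct_disjoint)
    case (basic A)
    then show ?case
      using meas eq by (auto simp: P_def)
  next
    case empty
    show ?case by (simp add: P_def)
  next
    case (compl A)
    then have A[measurable]: "A \<in> sets borel"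
      by (simp add: borel)
    have K_compl: "emeasure (K \<omega>) (UNIV - A) = emeasure (K \<omega>) UNIV - emeasure (K \<omega>) A" if "\<omega> \<in> space M" for \<omega>
      using emeasure_compl[of A "K \<omega>"] finite_measure.emeasure_finite[OF fin_K[OF that]]
      by (simp add: that sets_K space_K A)
    have [measurable]: "(\<lambda>\<omega>. emeasure (K \<omega>) A) \<in> borel_measurable M" "(\<lambda>\<omega>. emeasure (K \<omega>) UNIV) \<in> borel_measurable M"
      using compl P_UNIV by (auto simp: P_def)
    have "(\<lambda>\<omega>. emeasure (K \<omega>) UNIV - emeasure (K \<omega>) A) \<in> borel_measurable M"
      by measurable
    then have "(\<lambda>\<omega>. emeasure (K \<omega>) (UNIV - A)) \<in> borel_measurable M"
      by (subst measurable_cong[OF K_compl])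
    moreover have "(\<integral>\<^sup>+\<omega>. emeasure (K \<omega>) (UNIV - A) \<partial>M) = emeasure \<mu> (UNIV - A)"
    proof -
      have "(\<integral>\<^sup>+\<omega>. emeasure (K \<omega>) (UNIV - A) \<partial>M) = (\<integral>\<^sup>+\<omega>. emeasure (K \<omega>) UNIV - emeasure (K \<omega>) A \<partial>M)"
        by (intro nn_integral_cong K_compl)
      also have "\<dots> = (\<integral>\<^sup>+\<omega>. emeasure (K \<omega>) UNIV \<partial>M) - (\<integral>\<^sup>+\<omega>. emeasure (K \<omega>) A \<partial>M)"
      \<comment> \<open>Finiteness of \<open>\<mu>\<close> makes the subtracted integral finite, as
        subtraction in \<open>ennreal\<close> requires.\<close>
      proof (rule nn_integral_diff)
        show "(\<integral>\<^sup>+\<omega>. emeasure (K \<omega>) A \<partial>M) \<noteq> \<infinity>"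
          using compl fin[of A] by (simp add: P_def)
        show "AE \<omega> in M. emeasure (K \<omega>) A \<le> emeasure (K \<omega>) UNIV"
          by (auto intro!: emeasure_mono simp: sets_K)
      qed auto
      also have "\<dots> = emeasure \<mu> UNIV - emeasure \<mu> A"
        using compl P_UNIV by (simp add: P_def)
      also have "\<dots> = emeasure \<mu> (UNIV - A)"
        using emeasure_compl[of A \<mu>] fin[of A] by (simp add: sets_\<mu> space_\<mu> A)
      finally show ?thesis .
    qed
    ultimately show ?case
      by (simp add: P_def)
  next
    case (union A)
    then have A[measurable]: "A i \<in> sets borel" for i
      by (auto simp: borel)
    have K_UN: "emeasure (K \<omega>) (\<Union>i. A i) = (\<Sum>i. emeasure (K \<omega>) (A i))" if "\<omega> \<in> space M" for \<omega>
      using union A by (intro suminf_emeasure[symmetric]) (auto simp: sets_K that)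
    have meas_A[measurable]: "(\<lambda>\<omega>. emeasure (K \<omega>) (A i)) \<in> borel_measurable M" for i
      using union by (auto simp: P_def)
    have "(\<lambda>\<omega>. \<Sum>i. emeasure (K \<omega>) (A i)) \<in> borel_measurable M"
      by measurable
    then have "(\<lambda>\<omega>. emeasure (K \<omega>) (\<Union>i. A i)) \<in> borel_measurable M"
      by (subst measurable_cong[OF K_UN])
    moreover have "(\<integral>\<^sup>+\<omega>. emeasure (K \<omega>) (\<Union>i. A i) \<partial>M) = emeasure \<mu> (\<Union>i. A i)"
    proof -
      have "(\<integral>\<^sup>+\<omega>. emeasure (K \<omega>) (\<Union>i. A i) \<partial>M) = (\<integral>\<^sup>+\<omega>. (\<Sum>i. emeasure (K \<omega>) (A i)) \<partial>M)"
        by (intro nn_integral_cong K_UN)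
      also have "\<dots> = (\<Sum>i. \<integral>\<^sup>+\<omega>. emeasure (K \<omega>) (A i) \<partial>M)"
        by (rule nn_integral_suminf) (rule meas_A)
      also have "\<dots> = (\<Sum>i. emeasure \<mu> (A i))"
        using union by (simp add: P_def)
      also have "\<dots> = emeasure \<mu> (\<Union>i. A i)"
        using union A by (intro suminf_emeasure) (auto simp: sets_\<mu>)
      finally show ?thesis .
    qed
    ultimately show ?case
      by (simp add: P_def)
  qed
  have meas_K: "g \<in> borel_measurable (K \<omega>)" if "\<omega> \<in> space M" "g \<in> borel_measurable borel" for g :: "real \<Rightarrow> ennreal" and \<omega>
    using that(2) by (simp add: measurable_cong_sets[OF sets_K[OF that(1)] refl])
  have meas_\<mu>: "g \<in> borel_measurable \<mu>" if "g \<in> borel_measurable borel" for g :: "real \<Rightarrow> ennreal"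
    using that by (simp add: measurable_cong_sets[OF sets_\<mu> refl])
  have "(\<lambda>\<omega>. \<integral>\<^sup>+u. f u \<partial>K \<omega>) \<in> borel_measurable M \<and> (\<integral>\<^sup>+\<omega>. \<integral>\<^sup>+u. f u \<partial>K \<omega> \<partial>M) = (\<integral>\<^sup>+u. f u \<partial>\<mu>)"
    using f
  proof (induction rule: borel_measurable_induct)
    case (cong f g)
    then have "f = g" by auto
    with cong show ?case by simp
  next
    case (set A)
    have "(\<lambda>\<omega>. \<integral>\<^sup>+u. indicator A u \<partial>K \<omega>) \<in> borel_measurable M \<longleftrightarrow> (\<lambda>\<omega>. emeasure (K \<omega>) A) \<in> borel_measurable M"
      by (intro measurable_cong nn_integral_indicator) (simp add: sets_K set)
    moreover have "(\<integral>\<^sup>+\<omega>. \<integral>\<^sup>+u. indicator A u \<partial>K \<omega> \<partial>M) = (\<integral>\<^sup>+\<omega>. emeasure (K \<omega>) A \<partial>M)"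
      by (intro nn_integral_cong nn_integral_indicator) (simp add: sets_K set)
    ultimately show ?case
      using P_sets[OF set] set by (simp add: P_def sets_\<mu>)
  next
    case (mult g c)
    have *: "(\<integral>\<^sup>+u. c * g u \<partial>K \<omega>) = c * (\<integral>\<^sup>+u. g u \<partial>K \<omega>)" if "\<omega> \<in> space M" for \<omega>
      using mult by (intro nn_integral_cmult meas_K that)
    have "(\<lambda>\<omega>. \<integral>\<^sup>+u. c * g u \<partial>K \<omega>) \<in> borel_measurable M"
      using mult by (subst measurable_cong[OF *]) auto
    moreover have "(\<integral>\<^sup>+\<omega>. \<integral>\<^sup>+u. c * g u \<partial>K \<omega> \<partial>M) = (\<integral>\<^sup>+\<omega>. c * (\<integral>\<^sup>+u. g u \<partial>K \<omega>) \<partial>M)"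
      by (intro nn_integral_cong *)
    ultimately show ?case
      using mult by (simp add: nn_integral_cmult meas_\<mu>)
  next
    case (add g h)
    have *: "(\<integral>\<^sup>+u. h u + g u \<partial>K \<omega>) = (\<integral>\<^sup>+u. h u \<partial>K \<omega>) + (\<integral>\<^sup>+u. g u \<partial>K \<omega>)" if "\<omega> \<in> space M" for \<omega>
      using add by (intro nn_integral_add meas_K that)
    have "(\<lambda>\<omega>. \<integral>\<^sup>+u. h u + g u \<partial>K \<omega>) \<in> borel_measurable M"
      using add by (subst measurable_cong[OF *]) auto
    moreover have "(\<integral>\<^sup>+\<omega>. \<integral>\<^sup>+u. h u + g u \<partial>K \<omega> \<partial>M) = (\<integral>\<^sup>+\<omega>. (\<integral>\<^sup>+u. h u \<partial>K \<omega>) + (\<integral>\<^sup>+u. g u \<partial>K \<omega>) \<partial>M)"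
      by (intro nn_integral_cong *)
    ultimately show ?case
      using add by (simp add: nn_integral_add meas_\<mu>)
  next
    case (seq U)
    have inc: "incseq (\<lambda>i u. U i u)" using seq by simp
    have *: "(\<integral>\<^sup>+u. (SUP i. U i) u \<partial>K \<omega>) = (SUP i. \<integral>\<^sup>+u. U i u \<partial>K \<omega>)" if "\<omega> \<in> space M" for \<omega>
      using seq unfolding SUP_apply by (intro nn_integral_monotone_convergence_SUP meas_K that)
    have "(\<lambda>\<omega>. SUP i. \<integral>\<^sup>+u. U i u \<partial>K \<omega>) \<in> borel_measurable M"
      using seq by (intro borel_measurable_SUP) auto
    then have "(\<lambda>\<omega>. \<integral>\<^sup>+u. (SUP i. U i) u \<partial>K \<omega>) \<in> borel_measurable M"
      by (subst measurable_cong[OF *])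
    moreover have "(\<integral>\<^sup>+\<omega>. \<integral>\<^sup>+u. (SUP i. U i) u \<partial>K \<omega> \<partial>M) = (\<integral>\<^sup>+u. (SUP i. U i) u \<partial>\<mu>)"
    proof -
      have "(\<integral>\<^sup>+\<omega>. \<integral>\<^sup>+u. (SUP i. U i) u \<partial>K \<omega> \<partial>M) = (\<integral>\<^sup>+\<omega>. (SUP i. \<integral>\<^sup>+u. U i u \<partial>K \<omega>) \<partial>M)"
        by (intro nn_integral_cong *)
      also have "\<dots> = (SUP i. \<integral>\<^sup>+\<omega>. \<integral>\<^sup>+u. U i u \<partial>K \<omega> \<partial>M)"
        using seq by (intro nn_integral_monotone_convergence_SUP)
          (auto simp: incseq_def le_fun_def intro!: nn_integral_mono)
      also have "\<dots> = (SUP i. \<integral>\<^sup>+u. U i u \<partial>\<mu>)"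
        using seq by simp
      also have "\<dots> = (\<integral>\<^sup>+u. (SUP i. U i) u \<partial>\<mu>)"
        using seq unfolding SUP_apply
        by (intro nn_integral_monotone_convergence_SUP[symmetric] meas_\<mu>)
      finally show ?thesis .
    qed
    ultimately show ?case by simp
  qed
  then show "(\<lambda>\<omega>. \<integral>\<^sup>+u. f u \<partial>K \<omega>) \<in> borel_measurable M"
    "(\<integral>\<^sup>+\<omega>. \<integral>\<^sup>+u. f u \<partial>K \<omega> \<partial>M) = (\<integral>\<^sup>+u. f u \<partial>\<mu>)"
    by auto
qed

section \<open>Discrete expectations and the Poisson mean\<close>

lemma nn_integral_nat_valued:
  assumes X: "X \<in> measurable M (count_space UNIV)"
  shows "(\<integral>\<^sup>+\<omega>. f (X \<omega>) \<partial>M) = (\<Sum>m::nat. f m * emeasure M {\<omega> \<in> space M. X \<omega> = m})"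
proof -
  note [measurable] = X
  have "(\<integral>\<^sup>+\<omega>. f (X \<omega>) \<partial>M) = (\<integral>\<^sup>+\<omega>. (\<Sum>m. f m * indicator {\<omega> \<in> space M. X \<omega> = m} \<omega>) \<partial>M)"
  proof (rule nn_integral_cong)
    fix \<omega> assume "\<omega> \<in> space M"
    then have "(\<Sum>m. f m * indicator {\<omega> \<in> space M. X \<omega> = m} \<omega>) = (\<Sum>m\<in>{X \<omega>}. f m * indicator {\<omega> \<in> space M. X \<omega> = m} \<omega>)"
      by (intro suminf_finite) auto
    then show "f (X \<omega>) = (\<Sum>m. f m * indicator {\<omega> \<in> space M. X \<omega> = m} \<omega>)"
      using \<open>\<omega> \<in> space M\<close> by simp
  qed
  also have "\<dots> = (\<Sum>m. \<integral>\<^sup>+\<omega>. f m * indicator {\<omega> \<in> space M. X \<omega> = m} \<omega> \<partial>M)"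
    by (intro nn_integral_suminf) measurable
  also have "\<dots> = (\<Sum>m. f m * emeasure M {\<omega> \<in> space M. X \<omega> = m})"
    by (intro suminf_cong nn_integral_cmult_indicator) measurable
  finally show ?thesis .
qed

text \<open>With \<open>p m\<close> the weight at \<open>m\<close>, the identity
  \<open>Suc m * p (Suc m) = r * p m\<close> shifts the mean series to
  \<open>r * exp (- r) * exp r\<close>. The explicit weights cover \<open>r = 0\<close> as
  well.\<close>

lemma (in prob_space) poisson_mean:
  assumes X: "random_variable (count_space UNIV) X" and r: "0 \<le> r"
    and P: "\<And>m. prob {\<omega> \<in> space M. X \<omega> = m} = exp (- r) * r ^ m / fact m"
  shows "integrable M (\<lambda>\<omega>. real (X \<omega>))" "expectation (\<lambda>\<omega>. real (X \<omega>)) = r"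
proof -
  note [measurable] = X
  have "(\<lambda>m. r * exp (- r) * (r ^ m /\<^sub>R fact m)) sums (r * exp (- r) * exp r)"
    by (intro sums_mult exp_converges)
  moreover have "r * exp (- r) * (r ^ m /\<^sub>R fact m) = real (Suc m) * (exp (- r) * r ^ Suc m / fact (Suc m))" for m
    by (simp add: field_simps del: of_nat_Suc)
  moreover have "r * exp (- r) * exp r = r"
    by (simp add: exp_minus)
  ultimately have "(\<lambda>m. real (Suc m) * (exp (- r) * r ^ Suc m / fact (Suc m))) sums r"
    by simp
  \<comment> \<open>The term at index 0 is zero, so reinstating it leaves the sum unchanged.\<close>
  then have sums: "(\<lambda>m. real m * (exp (- r) * r ^ m / fact m)) sums r"
    by (subst (asm) sums_Suc_iff) simp
  have "(\<integral>\<^sup>+\<omega>. ennreal (real (X \<omega>)) \<partial>M) = (\<Sum>m. ennreal (real m) * emeasure M {\<omega> \<in> space M. X \<omega> = m})"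
    by (rule nn_integral_nat_valued[OF X])
  also have "\<dots> = (\<Sum>m. ennreal (real m * (exp (- r) * r ^ m / fact m)))"
    by (simp add: emeasure_eq_measure P ennreal_mult[symmetric] r)
  also have "\<dots> = ennreal r"
    using sums r by (intro suminf_ennreal_eq) auto
  finally have nn: "(\<integral>\<^sup>+\<omega>. ennreal (real (X \<omega>)) \<partial>M) = ennreal r" .
  then show "integrable M (\<lambda>\<omega>. real (X \<omega>))"
    by (intro integrableI_nonneg) auto
  show "expectation (\<lambda>\<omega>. real (X \<omega>)) = r"
    using nn r by (subst integral_eq_nn_integral) auto
qed

section \<open>Auxiliary facts on sums and interval integrals\<close>

text \<open>\<open>j\<close> is the first index at which the nondecreasing \<open>y\<close> reaches
  \<open>c\<close>, or \<open>m\<close> if there is none before \<open>m\<close>: earlier terms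
  telescope, and later ones vanish since \<open>y\<close> stays at or above \<open>c\<close>. The
  fact \<open>y 0 \<le> y j\<close> keeps the natural subtraction exact.\<close>

lemma sum_while_below_telescopes:
  fixes y :: "nat \<Rightarrow> nat"
  assumes "\<And>i. i < m \<Longrightarrow> y i \<le> y (Suc i)"
  obtains j where "j \<le> m" "(\<Sum>i<m. if y i < c then y (Suc i) - y i else 0) = y j - y 0"
    "y 0 \<le> y j" "j < m \<Longrightarrow> c \<le> y j" "\<And>i. i < j \<Longrightarrow> y i < c"
proof -
  have "\<exists>j\<le>m. (\<Sum>i<m. if y i < c then y (Suc i) - y i else 0) = y j - y 0 \<and>
    y 0 \<le> y j \<and> (j < m \<longrightarrow> c \<le> y j) \<and> (\<forall>i<j. y i < c)"
    using assms
  proof (induction m)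
    case (Suc m)
    have "\<exists>j\<le>m. (\<Sum>i<m. if y i < c then y (Suc i) - y i else 0) = y j - y 0 \<and>
      y 0 \<le> y j \<and> (j < m \<longrightarrow> c \<le> y j) \<and> (\<forall>i<j. y i < c)"
      by (rule Suc.IH) (simp add: Suc.prems)
    then obtain j where j: "j \<le> m" "(\<Sum>i<m. if y i < c then y (Suc i) - y i else 0) = y j - y 0"
        "y 0 \<le> y j" "j < m \<longrightarrow> c \<le> y j" "\<forall>i<j. y i < c"
      by blast
    show ?case
    proof (cases "c \<le> y j")
      case True
      \<comment> \<open>The level stays reached up to \<open>m\<close>, so the additional term is
        zero and the same \<open>j\<close> serves.\<close>
      have "c \<le> y m"
      proof -
        have "y j \<le> y m"
          using \<open>j \<le> m\<close> Suc.prems by (induction rule: dec_induct) (auto intro: order_trans)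
        with True show ?thesis by simp
      qed
      with True j show ?thesis
        by (intro exI[of _ j]) auto
    next
      case False
      \<comment> \<open>Nothing has stopped the sum so far, so the additional term is a full
        increment and the new index is \<open>Suc m\<close>.\<close>
      with j have "j = m" by auto
      with False j Suc.prems[of m] show ?thesis
        by (intro exI[of _ "Suc m"]) (auto simp: less_Suc_eq)
    qed
  qed auto
  with that show thesis by blast
qed

lemma set_borel_measurable_mult:
  fixes f g :: "_ \<Rightarrow> real"
  assumes "set_borel_measurable M A f" "set_borel_measurable M A g"
  shows "set_borel_measurable M A (\<lambda>x. f x * g x)"
proof -
  have "(\<lambda>x. (indicator A x *\<^sub>R f x) * (indicator A x *\<^sub>R g x)) \<in> borel_measurable M"
    using assms unfolding set_borel_measurable_def by (intro borel_measurable_times)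
  moreover have "(indicator A x *\<^sub>R f x) * (indicator A x *\<^sub>R g x) = indicator A x *\<^sub>R (f x * g x)" for x
    by (simp add: indicator_def)
  ultimately show ?thesis
    unfolding set_borel_measurable_def by (simp only:)
qed

lemma set_borel_measurable_of_restrict_space:
  fixes f :: "real \<Rightarrow> real"
  assumes f: "f \<in> borel_measurable (restrict_space borel B)" and B: "B \<in> sets borel"
    and A: "A \<in> sets borel" "A \<subseteq> B"
  shows "set_borel_measurable lborel A f"
proof -
  have "set_borel_measurable borel B f"
    using f B by (simp add: set_borel_measurable_def borel_measurable_restrict_space_iff mult.commute)
  then have "set_borel_measurable borel A f"
    by (rule set_borel_measurable_subset) (use A in auto)
  then show ?thesis
    by (simp add: set_borel_measurable_def)
qed

text \<open>The two sets differ by at most the null point \<open>a\<close>. Stochastic integrals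
  lead to half-open intervals, whereas the final formulas use closed ones.\<close>

lemma LBINT_Ioc_eq_Icc: "(LBINT u:{a<..b}. f u) = (LBINT u:{a..b}. f u)" for f :: "real \<Rightarrow> real"
  by (rule set_integral_discrete_difference[where X="{a}"]) auto

text \<open>The shortfall counts the levels \<open>n < x\<close> with \<open>m \<le> n\<close>; the
  form \<open>m < Suc n\<close> matches the events of \<open>prob_below\<close> at level
  \<open>Suc n\<close>.\<close>

lemma stock_shortfall_eq_sum:
  "max 0 (real x - real m) = (\<Sum>n<x. if m < Suc n then 1 else 0)"
proof (induction x)
  case (Suc x)
  have "max 0 (real (Suc x) - real m) = max 0 (real x - real m) + (if m < Suc x then 1 else 0)"
    by (auto simp: max_def)
  with Suc show ?case by simp
qed simp

section \<open>Intensity and Poisson increments\<close>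

locale intensity_poisson_process = nonhomogeneous_poisson_process M S lam N
  for M :: "'a measure" and S lam N +
  assumes intensity: "intensity_function S lam"
begin

abbreviation \<Lambda> where "\<Lambda> \<equiv> cumulative_intensity lam"

lemma lam_nonneg: "t \<in> {0..S} \<Longrightarrow> 0 \<le> lam t"
  and lam_antimono: "s \<in> {0..S} \<Longrightarrow> t \<in> {0..S} \<Longrightarrow> s \<le> t \<Longrightarrow> lam t \<le> lam s"
  using intensity by (auto simp: intensity_function_def)

text \<open>Monotone functions are Borel measurable; the sign change turns the nonincreasing
  intensity into a nondecreasing function.\<close>

lemma lam_measurable: "lam \<in> borel_measurable (restrict_space borel {0..S})"
proof -
  have "(\<lambda>t. - lam t) \<in> borel_measurable (restrict_space borel {0..S})"
    by (rule borel_measurable_mono_on_fnc) (auto simp: mono_on_def intro: lam_antimono)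
  then show ?thesis by simp
qed

text \<open>Being nonincreasing, \<open>lam\<close> is bounded on the horizon by its initial value
  \<open>lam 0\<close>.\<close>

lemma lam_integrable:
  assumes A: "A \<in> sets borel" "A \<subseteq> {0..S}"
  shows "set_integrable lborel A lam"
proof -
  have "set_integrable lborel {0..S} lam"
  proof (rule set_integrable_bound)
    show "set_integrable lborel {0..S} (\<lambda>_. lam 0)"
      by (cases "0 \<le> S") (auto simp: set_integrable_def)
    show "set_borel_measurable lborel {0..S} lam"
      by (rule set_borel_measurable_of_restrict_space[OF lam_measurable]) auto
    show "AE t in lborel. t \<in> {0..S} \<longrightarrow> norm (lam t) \<le> norm (lam 0)"
      by (auto simp: lam_nonneg intro!: lam_antimono)
  qed
  then show ?thesis
    by (rule set_integrable_subset) (use A in auto)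
qed

lemma \<Lambda>_diff:
  assumes "0 \<le> s" "s \<le> t" "t \<le> S"
  shows "\<Lambda> t - \<Lambda> s = (LBINT u:{s<..t}. lam u)"
proof -
  have "{0..t} = {0..s} \<union> {s<..t}"
    using assms by auto
  moreover have "(LBINT u:{0..s} \<union> {s<..t}. lam u) = (LBINT u:{0..s}. lam u) + (LBINT u:{s<..t}. lam u)"
    by (rule set_integral_Un) (use assms in \<open>auto intro!: lam_integrable\<close>)
  ultimately show ?thesis
    by (simp add: cumulative_intensity_def)
qed

lemma \<Lambda>_mono: "0 \<le> s \<Longrightarrow> s \<le> t \<Longrightarrow> t \<le> S \<Longrightarrow> \<Lambda> s \<le> \<Lambda> t"
  unfolding diff_ge_0_iff_ge[of "\<Lambda> t", symmetric]
  by (subst \<Lambda>_diff) (auto simp: set_lebesgue_integral_def indicator_def lam_nonneg intro!: integral_nonneg)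

lemma increment_measurable:
  "s \<in> {0..S} \<Longrightarrow> t \<in> {0..S} \<Longrightarrow> (\<lambda>\<omega>. N t \<omega> - N s \<omega>) \<in> measurable M (count_space UNIV)"
  by (intro measurable_compose_countable'[where I=UNIV and g="N t" and f="\<lambda>n \<omega>. n - N s \<omega>"]
        measurable_compose[OF measurable_N[of s]] measurable_N) auto

lemma increment_mean:
  assumes "0 \<le> s" "s \<le> t" "t \<le> S"
  shows "integrable M (\<lambda>\<omega>. real (N t \<omega> - N s \<omega>))"
    and "expectation (\<lambda>\<omega>. real (N t \<omega> - N s \<omega>)) = \<Lambda> t - \<Lambda> s"
  using poisson_mean[of "\<lambda>\<omega>. N t \<omega> - N s \<omega>" "\<Lambda> t - \<Lambda> s"] increment_measurable[of s t]
    poisson_increments[of s t] \<Lambda>_mono[of s t] assms by auto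

section \<open>Probability of staying below a level\<close>

text \<open>This is the probability that a stock of \<open>x\<close> at time \<open>a\<close> is not
  yet exhausted at \<open>u\<close>. It will be the factor that multiplies \<open>lam u\<close> in
  the mean of the arrivals stopped at stockout.\<close>

definition prob_below :: "real \<Rightarrow> nat \<Rightarrow> real \<Rightarrow> real" where
  "prob_below a x u = prob {\<omega> \<in> space M. N u \<omega> - N a \<omega> < x}"

lemma prob_below_eq:
  assumes "0 \<le> a" "a \<le> u" "u \<le> S"
  shows "prob_below a x u = (\<Sum>i<x. exp (- (\<Lambda> u - \<Lambda> a)) * (\<Lambda> u - \<Lambda> a) ^ i / fact i)"
proof -
  have [measurable]: "(\<lambda>\<omega>. N u \<omega> - N a \<omega>) \<in> measurable M (count_space UNIV)"
    using assms by (intro increment_measurable) auto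
  have "{\<omega> \<in> space M. N u \<omega> - N a \<omega> < x} = (\<Union>i<x. {\<omega> \<in> space M. N u \<omega> - N a \<omega> = i})"
    by auto
  then have "prob_below a x u = prob (\<Union>i<x. {\<omega> \<in> space M. N u \<omega> - N a \<omega> = i})"
    by (simp add: prob_below_def)
  also have "\<dots> = (\<Sum>i<x. prob {\<omega> \<in> space M. N u \<omega> - N a \<omega> = i})"
  proof (rule finite_measure_finite_Union)
    show "(\<lambda>i. {\<omega> \<in> space M. N u \<omega> - N a \<omega> = i}) ` {..<x} \<subseteq> events"
      by (auto; measurable)
  qed (auto simp: disjoint_family_on_def)
  finally show ?thesis
    using assms by (simp add: poisson_increments)
qed

text \<open>Paths are nondecreasing, so the event shrinks with time. This gives both Borel
  measurability in \<open>u\<close> and the error bound for left sums.\<close>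

lemma prob_below_antimono:
  assumes "0 \<le> a" "a \<le> u" "u \<le> v" "v \<le> S"
  shows "prob_below a x v \<le> prob_below a x u"
  unfolding prob_below_def
proof (rule finite_measure_mono)
  have [measurable]: "(\<lambda>\<omega>. N u \<omega> - N a \<omega>) \<in> measurable M (count_space UNIV)"
    using assms by (intro increment_measurable) auto
  show "{\<omega> \<in> space M. N u \<omega> - N a \<omega> < x} \<in> events"
    by measurable
  show "{\<omega> \<in> space M. N v \<omega> - N a \<omega> < x} \<subseteq> {\<omega> \<in> space M. N u \<omega> - N a \<omega> < x}"
    using assms paths_mono[of _ u v] by (auto intro: le_less_trans[OF diff_le_mono])
qed

text \<open>The indicator depends on the increment over \<open>(a, s]\<close> and the other factor
  on the increment over \<open>(s, t]\<close>, so independence makes the mean a product.\<close>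

lemma expected_increment_below:
  assumes "0 \<le> a" "a \<le> s" "s \<le> t" "t \<le> S"
  shows "integrable M (\<lambda>\<omega>. if N s \<omega> - N a \<omega> < x then real (N t \<omega> - N s \<omega>) else 0)"
    and "expectation (\<lambda>\<omega>. if N s \<omega> - N a \<omega> < x then real (N t \<omega> - N s \<omega>) else 0) =
      (\<Lambda> t - \<Lambda> s) * prob_below a x s"
proof -
  \<comment> \<open>The grid \<open>a\<close>, \<open>s\<close>, \<open>t\<close> has two
    consecutive increments; \<open>Y\<close> sends the first to the indicator of staying below
    \<open>x\<close> and the second to its real value.\<close>
  define \<tau> where "\<tau> i = (if i = 0 then a else if i = 1 then s else t)" for i :: nat
  define Y where "Y i n = (if i = 0 then indicator {..<x} n else real n)" for i n :: nat
  define X where "X i \<omega> = Y i (N (\<tau> (Suc i)) \<omega> - N (\<tau> i) \<omega>)" for i \<omega>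
  have "indep_vars (\<lambda>_. count_space UNIV) (\<lambda>i \<omega>. N (\<tau> (Suc i)) \<omega> - N (\<tau> i) \<omega>) {..<2}"
    by (rule independent_increments) (use assms in \<open>auto simp: \<tau>_def\<close>)
  then have indep: "indep_vars (\<lambda>_. borel) X {..<2}"
    unfolding X_def by (rule indep_vars_compose2) auto
  have [measurable]: "(\<lambda>\<omega>. N s \<omega> - N a \<omega>) \<in> measurable M (count_space UNIV)"
    using assms by (intro increment_measurable) auto
  have X0: "X 0 = indicator {\<omega>. N s \<omega> - N a \<omega> < x}"
    by (auto simp: X_def \<tau>_def Y_def indicator_def)
  have X1: "X (Suc 0) = (\<lambda>\<omega>. real (N t \<omega> - N s \<omega>))"
    by (simp add: fun_eq_iff X_def \<tau>_def Y_def)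
  have meas: "{\<omega> \<in> space M. N s \<omega> - N a \<omega> < x} \<in> events"
    by measurable
  \<comment> \<open>As a function, \<open>X 0\<close> is the indicator of a set that may leave
    \<open>space M\<close>; its intersection with \<open>space M\<close> is the event.\<close>
  have cong: "X 0 \<omega> = indicator {\<omega> \<in> space M. N s \<omega> - N a \<omega> < x} \<omega>" if "\<omega> \<in> space M" for \<omega>
    using that by (simp add: X0 indicator_def)
  have int: "integrable M (X i)" if "i \<in> {..<2}" for i
  proof (cases "i = 0")
    case True
    then show ?thesis
      using meas by (subst Bochner_Integration.integrable_cong[OF refl, of _ "X i" "indicator {\<omega> \<in> space M. N s \<omega> - N a \<omega> < x}"])
        (auto simp: cong less_top[symmetric])
  next
    case False
    with that have "i = Suc 0" by auto
    then show ?thesis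
      using increment_mean(1)[of s t] assms by (simp add: X1)
  qed
  have E0: "expectation (X 0) = prob_below a x s"
    using meas by (subst Bochner_Integration.integral_cong[OF refl cong]) (auto simp: prob_below_def)
  have prod: "(\<Prod>i<2. X i \<omega>) = (if N s \<omega> - N a \<omega> < x then real (N t \<omega> - N s \<omega>) else 0)" for \<omega>
    by (simp add: numeral_2_eq_2 X0 X1)
  show "integrable M (\<lambda>\<omega>. if N s \<omega> - N a \<omega> < x then real (N t \<omega> - N s \<omega>) else 0)"
    using indep_vars_integrable[OF _ indep int] by (simp add: prod)
  show "expectation (\<lambda>\<omega>. if N s \<omega> - N a \<omega> < x then real (N t \<omega> - N s \<omega>) else 0) =
      (\<Lambda> t - \<Lambda> s) * prob_below a x s"
    using indep_vars_lebesgue_integral[OF _ indep int] increment_mean(2)[of s t] assms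
    by (simp add: prod) (simp add: numeral_2_eq_2 E0 X1)
qed

section \<open>Step paths and the jump measure\<close>

text \<open>Path values are integers, so two values at distance less than 1 coincide;
  right-continuity becomes local constancy to the right.\<close>

lemma locally_constant_right:
  assumes \<omega>: "\<omega> \<in> space M" and u: "u \<in> {0..<S}"
  obtains d where "u < d" "\<And>v. u \<le> v \<Longrightarrow> v < d \<Longrightarrow> N v \<omega> = N u \<omega>"
proof -
  have "\<forall>\<^sub>F v in at_right u. dist (real (N v \<omega>)) (real (N u \<omega>)) < 1"
    using tendstoD[OF paths_right_continuous[OF \<omega> u]] by simp
  then obtain d where d: "u < d" "\<And>v. u < v \<Longrightarrow> v < d \<Longrightarrow> dist (real (N v \<omega>)) (real (N u \<omega>)) < 1"
    unfolding eventually_at_right_field by blast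
  have "N v \<omega> = N u \<omega>" if "u \<le> v" "v < d" for v
    using d(2)[of v] that by (cases "v = u") (auto simp: dist_real_def)
  with d(1) that show thesis by blast
qed

text \<open>Clamping extends the path constantly outside \<open>[0, S]\<close>, so local constancy
  to the right holds at every real \<open>u\<close>.\<close>

lemma clamped_locally_constant_right:
  assumes \<omega>: "\<omega> \<in> space M" and S: "0 \<le> S"
  obtains d where "u < d"
    "\<And>v. u < v \<Longrightarrow> v < d \<Longrightarrow> N (max 0 (min S v)) \<omega> = N (max 0 (min S u)) \<omega>"
proof -
  consider "u < 0" | "u \<in> {0..<S}" | "S \<le> u"
    by fastforce
  then show thesis
  proof cases
    case 1
    with that[of 0] S show thesis by simp
  next
    case 2
    obtain d where d: "u < d" "\<And>v. u \<le> v \<Longrightarrow> v < d \<Longrightarrow> N v \<omega> = N u \<omega>"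
      using locally_constant_right[OF \<omega> 2] by blast
    show thesis
    proof (rule that[of "min d S"])
      show "N (max 0 (min S v)) \<omega> = N (max 0 (min S u)) \<omega>" if "u < v" "v < min d S" for v
        using d(2)[of v] that 2 by simp
    qed (use d 2 in auto)
  next
    case 3
    with that[of "u + 1"] S show thesis by simp
  qed
qed

text \<open>The clamped path is nondecreasing and right-continuous on the whole line, so its
  Stieltjes measure is determined by the increments over half-open intervals.\<close>

lemma emeasure_jump_measure:
  assumes \<omega>: "\<omega> \<in> space M" and st: "0 \<le> s" "s \<le> t" "t \<le> S"
  shows "emeasure (jump_measure S N \<omega>) {s<..t} = ennreal (real (N t \<omega> - N s \<omega>))"
proof -
  define F where "F u = real (N (max 0 (min S u)) \<omega>)" for u
  have mono: "F u \<le> F v" if "u \<le> v" for u v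
    unfolding F_def using that st by (intro of_nat_mono paths_mono[OF \<omega>]) auto
  have cont: "continuous (at_right u) F" for u
  proof -
    obtain d where "u < d" "\<And>v. u < v \<Longrightarrow> v < d \<Longrightarrow> N (max 0 (min S v)) \<omega> = N (max 0 (min S u)) \<omega>"
      using clamped_locally_constant_right[OF \<omega>, of u] st by auto
    then have d: "u < d" "\<And>v. u < v \<Longrightarrow> v < d \<Longrightarrow> F v = F u"
      by (simp_all add: F_def)
    have "\<forall>\<^sub>F v in at_right u. F v = F u"
      unfolding eventually_at_right_field using d by blast
    then show ?thesis
      unfolding continuous_within by (rule tendsto_eventually)
  qed
  have "emeasure (interval_measure F) {s<..t} = ennreal (F t - F s)"
    by (rule emeasure_interval_measure_Ioc[OF st(2) mono cont])
  moreover have "F t - F s = real (N t \<omega> - N s \<omega>)"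
    using paths_mono[OF \<omega>, of s t] st by (simp add: F_def)
  moreover have "jump_measure S N \<omega> = interval_measure F"
    by (simp add: jump_measure_def F_def[abs_def])
  ultimately show ?thesis
    by simp
qed

section \<open>Mean of the stopped increment\<close>

lemma prob_below_measurable:
  assumes "0 \<le> a" "A \<in> sets borel" "A \<subseteq> {a..S}"
  shows "set_borel_measurable lborel A (prob_below a x)"
proof -
  have "(\<lambda>u. - prob_below a x u) \<in> borel_measurable (restrict_space borel {a..S})"
    by (rule borel_measurable_mono_on_fnc) (auto simp: mono_on_def intro: prob_below_antimono assms)
  then have "prob_below a x \<in> borel_measurable (restrict_space borel {a..S})"
    by simp
  then show ?thesis
    by (rule set_borel_measurable_of_restrict_space) (use assms in auto)
qed

lemma prob_below_bounds: "0 \<le> prob_below a x u" "prob_below a x u \<le> 1"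
  by (auto simp: prob_below_def)

lemma integrable_times_prob_below:
  assumes f: "set_integrable lborel A f" and a: "0 \<le> a" and A: "A \<in> sets borel" "A \<subseteq> {a..S}"
  shows "set_integrable lborel A (\<lambda>u. f u * prob_below a x u)"
proof (rule set_integrable_bound[OF f])
  have "set_borel_measurable lborel A f"
    using f by (simp add: set_integrable_def set_borel_measurable_def)
  then show "set_borel_measurable lborel A (\<lambda>u. f u * prob_below a x u)"
    by (rule set_borel_measurable_mult) (rule prob_below_measurable[OF a A])
  show "AE u in lborel. u \<in> A \<longrightarrow> norm (f u * prob_below a x u) \<le> norm (f u)"
    using prob_below_bounds by (auto simp: abs_mult intro!: mult_left_le)
qed

text \<open>For \<open>w\<close> in \<open>(u, v]\<close>, monotonicity places
  \<open>prob_below a x w\<close> between its values at \<open>v\<close> and \<open>u\<close>, while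
  \<open>lam w \<le> lam 0\<close>. A bound by a difference of \<open>prob_below\<close> lets the
  errors telescope over a grid.\<close>

lemma left_sum_error:
  fixes x :: nat
  assumes "0 \<le> a" "a \<le> u" "u \<le> v" "v \<le> S"
  defines "I \<equiv> (LBINT w:{u<..v}. lam w * prob_below a x w)"
  shows "I \<le> (\<Lambda> v - \<Lambda> u) * prob_below a x u"
    and "(\<Lambda> v - \<Lambda> u) * prob_below a x u - I \<le> lam 0 * (v - u) * (prob_below a x u - prob_below a x v)"
proof -
  let ?p = "prob_below a x"
  have lam: "set_integrable lborel {u<..v} lam"
    by (rule lam_integrable) (use assms in auto)
  have lam_p: "set_integrable lborel {u<..v} (\<lambda>w. lam w * ?p w)"
    by (rule integrable_times_prob_below[OF lam]) (use assms in auto)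
  have lam_c: "set_integrable lborel {u<..v} (\<lambda>w. lam w * ?p u)"
    using lam by simp
  have "(\<Lambda> v - \<Lambda> u) * ?p u = (LBINT w:{u<..v}. lam w) * ?p u"
    by (subst \<Lambda>_diff) (use assms in auto)
  then have c: "(\<Lambda> v - \<Lambda> u) * ?p u = (LBINT w:{u<..v}. lam w * ?p u)"
    by simp
  show "I \<le> (\<Lambda> v - \<Lambda> u) * ?p u"
    unfolding c I_def
    by (rule set_integral_mono[OF lam_p lam_c])
      (use assms in \<open>auto intro!: mult_left_mono prob_below_antimono lam_nonneg\<close>)
  have "(\<Lambda> v - \<Lambda> u) * ?p u - I = (LBINT w:{u<..v}. lam w * ?p u - lam w * ?p w)"
    unfolding c I_def by (rule set_integral_diff(2)[symmetric, OF lam_c lam_p])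
  also have "\<dots> \<le> (LBINT w:{u<..v}. lam 0 * (?p u - ?p v))"
  proof (rule set_integral_mono)
    show "set_integrable lborel {u<..v} (\<lambda>w. lam w * ?p u - lam w * ?p w)"
      by (rule set_integral_diff(1)[OF lam_c lam_p])
    show "set_integrable lborel {u<..v} (\<lambda>w. lam 0 * (?p u - ?p v))"
      using assms by (simp add: set_integrable_def)
    fix w assume w: "w \<in> {u<..v}"
    show "lam w * ?p u - lam w * ?p w \<le> lam 0 * (?p u - ?p v)"
      unfolding right_diff_distrib[symmetric]
      using w assms prob_below_antimono[of a u w x] prob_below_antimono[of a w v x] lam_antimono[of 0 w]
      by (intro mult_mono) (auto intro: lam_nonneg)
  qed
  also have "\<dots> = lam 0 * (v - u) * (?p u - ?p v)"
    using assms by (simp add: set_lebesgue_integral_def)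
  finally show "(\<Lambda> v - \<Lambda> u) * ?p u - I \<le> lam 0 * (v - u) * (?p u - ?p v)" .
qed

text \<open>The left sums converge pathwise to the stopped increment and in mean to the integral;
  dominated convergence identifies the two limits. The cut-off \<open>\<beta>\<close> is specified
  through the times strictly before and strictly after it, which is what an infimum
  provides.\<close>

lemma stopped_increment_mean:
  assumes a: "0 \<le> a" "a \<le> t" "t \<le> b" "b \<le> S"
    and \<beta>: "\<And>\<omega>. \<omega> \<in> space M \<Longrightarrow> a \<le> \<beta> \<omega>"
    and before: "\<And>\<omega> u. \<omega> \<in> space M \<Longrightarrow> a \<le> u \<Longrightarrow> u < \<beta> \<omega> \<Longrightarrow> u \<le> b \<Longrightarrow> N u \<omega> - N a \<omega> < x"
    and after: "\<And>\<omega> u. \<omega> \<in> space M \<Longrightarrow> \<beta> \<omega> < u \<Longrightarrow> u \<le> b \<Longrightarrow> x \<le> N u \<omega> - N a \<omega>"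
  shows "integrable M (\<lambda>\<omega>. real (N (min t (\<beta> \<omega>)) \<omega> - N a \<omega>))"
    and "expectation (\<lambda>\<omega>. real (N (min t (\<beta> \<omega>)) \<omega> - N a \<omega>)) =
      (LBINT u:{a<..t}. lam u * prob_below a x u)"
proof -
  let ?p = "prob_below a x"
  \<comment> \<open>\<open>Suc n\<close> equal steps divide \<open>[a, t]\<close>: the grid
    \<open>g n\<close> runs from \<open>a\<close> to \<open>t\<close> and its mesh
    \<open>h n\<close> tends to 0.\<close>
  define h where "h n = (t - a) / real (Suc n)" for n
  define g where "g n i = a + real i * h n" for n i
  define Z where "Z n \<omega> = (\<Sum>i<Suc n. if N (g n i) \<omega> - N a \<omega> < x
    then real (N (g n (Suc i)) \<omega> - N (g n i) \<omega>) else 0)" for n \<omega>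
  have h_nonneg: "0 \<le> h n" for n
    using a by (simp add: h_def)
  have h_lim: "h \<longlonglongrightarrow> 0"
    unfolding h_def using LIMSEQ_inverse_real_of_nat[THEN tendsto_mult_left, of "t - a"]
    by (simp add: divide_inverse)
  have g_end: "g n (Suc n) = t" for n
    by (simp add: g_def h_def)
  have g_Suc: "g n (Suc i) = g n i + h n" for n i
    by (simp add: g_def algebra_simps)
  have g_mono: "g n i \<le> g n j" if "i \<le> j" for n i j
    using that h_nonneg by (auto simp: g_def intro: mult_right_mono)
  have g_0: "g n 0 = a" for n
    by (simp add: g_def)
  have g_bounds: "a \<le> g n i" "i \<le> Suc n \<Longrightarrow> g n i \<le> t" for n i
    using g_mono[of 0 i n] g_mono[of i "Suc n" n] by (auto simp: g_0 g_end)
  \<comment> \<open>The sum stops at the first grid time \<open>r\<close> at which the level is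
    reached, or at \<open>t\<close>; it overshoots \<open>min t (\<beta> \<omega>)\<close> by at
    most one mesh.\<close>
  have path: "\<exists>r. Z n \<omega> = real (N r \<omega> - N a \<omega>) \<and> min t (\<beta> \<omega>) \<le> r \<and> r \<le> min t (\<beta> \<omega>) + h n \<and> r \<le> t"
    if \<omega>: "\<omega> \<in> space M" for \<omega> n
  proof -
    have mono: "N (g n i) \<omega> \<le> N (g n j) \<omega>" if "i \<le> j" "j \<le> Suc n" for i j
      using that g_bounds[of n i] g_bounds[of j n] g_mono[of i j n] a
      by (intro paths_mono[OF \<omega>]) auto
    \<comment> \<open>The level is \<open>N a \<omega> + x\<close> because the telescoping runs on
      the path itself, not on its increments from \<open>a\<close>.\<close>
    obtain j where j: "j \<le> Suc n"
        "(\<Sum>i<Suc n. if N (g n i) \<omega> < N a \<omega> + x then N (g n (Suc i)) \<omega> - N (g n i) \<omega> else 0) =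
          N (g n j) \<omega> - N (g n 0) \<omega>"
        "j < Suc n \<Longrightarrow> N a \<omega> + x \<le> N (g n j) \<omega>" "\<And>i. i < j \<Longrightarrow> N (g n i) \<omega> < N a \<omega> + x"
      by (rule sum_while_below_telescopes[of "Suc n" "\<lambda>i. N (g n i) \<omega>" "N a \<omega> + x"])
        (auto intro: mono)
    have iff: "N (g n i) \<omega> - N a \<omega> < x \<longleftrightarrow> N (g n i) \<omega> < N a \<omega> + x" if "i < Suc n" for i
      using mono[of 0 i] that by (auto simp: g_0)
    have "Z n \<omega> = real (\<Sum>i<Suc n. if N (g n i) \<omega> < N a \<omega> + x then N (g n (Suc i)) \<omega> - N (g n i) \<omega> else 0)"
      unfolding Z_def of_nat_sum by (intro sum.cong) (auto simp: iff)
    then have Z: "Z n \<omega> = real (N (g n j) \<omega> - N a \<omega>)"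
      by (simp only: j(2) g_0)
    have "min t (\<beta> \<omega>) \<le> g n j"
    proof (cases "j = Suc n")
      case False
      \<comment> \<open>The level is reached at \<open>g n j\<close>, so \<open>before\<close>
        excludes \<open>g n j < \<beta> \<omega>\<close>.\<close>
      then have "\<not> N (g n j) \<omega> - N a \<omega> < x"
        using j by auto
      then show ?thesis
        using before[OF \<omega>, of "g n j"] g_bounds(1)[of n j] g_bounds(2)[of j n] j(1) a by force
    qed (simp add: g_end)
    moreover have "g n j \<le> min t (\<beta> \<omega>) + h n"
    proof (cases j)
      case 0
      then show ?thesis
        using a \<beta>[OF \<omega>] h_nonneg[of n] by (simp add: g_0)
    next
      case (Suc i)
      \<comment> \<open>The preceding grid time is still below the level, so \<open>after\<close>
        places it no later than \<open>\<beta> \<omega>\<close>; the next one is \<open>h n\<close>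
        further.\<close>
      have "\<not> x \<le> N (g n i) \<omega> - N a \<omega>"
        using j(4)[of i] iff[of i] j(1) Suc by auto
      then show ?thesis
        using after[OF \<omega>, of "g n i"] g_bounds(2)[of i n] j(1) a Suc g_Suc[of n i] by force
    qed
    ultimately show ?thesis
      using Z g_bounds(2)[OF j(1)] by blast
  qed
  have lim: "(\<lambda>n. Z n \<omega>) \<longlonglongrightarrow> real (N (min t (\<beta> \<omega>)) \<omega> - N a \<omega>)" if \<omega>: "\<omega> \<in> space M" for \<omega>
  proof -
    \<comment> \<open>The sums are eventually constant in \<open>n\<close>: either
      \<open>m = t\<close>, which forces \<open>r = t\<close>, or \<open>m < t\<close> and
      \<open>r\<close> falls into a right neighbourhood of \<open>m\<close> on which the path is
      constant.\<close>
    define m where "m = min t (\<beta> \<omega>)"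
    have m: "a \<le> m" "m \<le> t"
      using a \<beta>[OF \<omega>] by (auto simp: m_def)
    have "\<forall>\<^sub>F n in sequentially. Z n \<omega> = real (N m \<omega> - N a \<omega>)"
    proof (cases "m = t")
      case True
      have "Z n \<omega> = real (N m \<omega> - N a \<omega>)" for n
      proof -
        obtain r where "Z n \<omega> = real (N r \<omega> - N a \<omega>)" "m \<le> r" "r \<le> t"
          using path[OF \<omega>, of n] by (auto simp: m_def)
        with True show ?thesis by simp
      qed
      then show ?thesis by simp
    next
      case False
      then have "m \<in> {0..<S}"
        using m a by auto
      then obtain d where d: "m < d" "\<And>v. m \<le> v \<Longrightarrow> v < d \<Longrightarrow> N v \<omega> = N m \<omega>"
        using locally_constant_right[OF \<omega>] by blast
      have "\<forall>\<^sub>F n in sequentially. h n < d - m"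
        using h_lim d(1) by (intro order_tendstoD) auto
      then show ?thesis
      proof eventually_elim
        case (elim n)
        obtain r where "Z n \<omega> = real (N r \<omega> - N a \<omega>)" "m \<le> r" "r \<le> m + h n"
          using path[OF \<omega>, of n] by (auto simp: m_def)
        with d(2)[of r] elim show ?case by simp
      qed
    qed
    then show ?thesis
      unfolding m_def by (rule tendsto_eventually)
  qed
  have bound: "norm (Z n \<omega>) \<le> real (N t \<omega> - N a \<omega>)" if \<omega>: "\<omega> \<in> space M" for \<omega> n
  proof -
    obtain r where r: "Z n \<omega> = real (N r \<omega> - N a \<omega>)" "min t (\<beta> \<omega>) \<le> r" "r \<le> t"
      using path[OF \<omega>] by blast
    have "N r \<omega> \<le> N t \<omega>"
      using r a \<beta>[OF \<omega>] by (intro paths_mono[OF \<omega>]) auto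
    then show ?thesis
      by (simp add: r(1) diff_le_mono)
  qed
  have summand: "integrable M (\<lambda>\<omega>. if N (g n i) \<omega> - N a \<omega> < x then real (N (g n (Suc i)) \<omega> - N (g n i) \<omega>) else 0)"
    "expectation (\<lambda>\<omega>. if N (g n i) \<omega> - N a \<omega> < x then real (N (g n (Suc i)) \<omega> - N (g n i) \<omega>) else 0) =
      (\<Lambda> (g n (Suc i)) - \<Lambda> (g n i)) * ?p (g n i)" if "i < Suc n" for n i
    using expected_increment_below[of a "g n i" "g n (Suc i)" x] a g_bounds[of n i]
      g_bounds(2)[of "Suc i" n] g_mono[of i "Suc i" n] that by auto
  have Z_int: "integrable M (Z n)" for n
    unfolding Z_def by (intro Bochner_Integration.integrable_sum summand) auto
  have EZ: "expectation (Z n) = (\<Sum>i<Suc n. (\<Lambda> (g n (Suc i)) - \<Lambda> (g n i)) * ?p (g n i))" for n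
    unfolding Z_def by (subst Bochner_Integration.integral_sum) (auto simp: summand)
  \<comment> \<open>Measurability of the stopped increment is inherited from the sums
    \<open>Z n\<close>, whose pointwise limit it is.\<close>
  have meas: "(\<lambda>\<omega>. real (N (min t (\<beta> \<omega>)) \<omega> - N a \<omega>)) \<in> borel_measurable M"
    by (rule borel_measurable_LIMSEQ_real[OF lim]) (use Z_int in auto)
  have dom: "integrable M (\<lambda>\<omega>. real (N t \<omega> - N a \<omega>))"
    using a by (intro increment_mean) auto
  show "integrable M (\<lambda>\<omega>. real (N (min t (\<beta> \<omega>)) \<omega> - N a \<omega>))"
    by (rule integrable_dominated_convergence[where s=Z, OF meas _ dom])
      (use Z_int lim bound in auto)
  have "(\<lambda>n. expectation (Z n)) \<longlonglongrightarrow> expectation (\<lambda>\<omega>. real (N (min t (\<beta> \<omega>)) \<omega> - N a \<omega>))"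
    by (rule integral_dominated_convergence[where s=Z, OF meas _ dom])
      (use Z_int lim bound in auto)
  moreover have "(\<lambda>n. expectation (Z n)) \<longlonglongrightarrow> (LBINT u:{a<..t}. lam u * ?p u)"
  proof -
    \<comment> \<open>\<open>G\<close> is the candidate limit as a function of its endpoint; its
      increments over the grid cells are compared with the terms of the left sums.\<close>
    define G where "G v = (LBINT u:{a<..v}. lam u * ?p u)" for v
    have G_diff: "G v - G u = (LBINT w:{u<..v}. lam w * ?p w)" if "a \<le> u" "u \<le> v" "v \<le> t" for u v
    proof -
      have "{a<..v} = {a<..u} \<union> {u<..v}"
        using that by auto
      moreover have "(LBINT w:{a<..u} \<union> {u<..v}. lam w * ?p w) =
          (LBINT w:{a<..u}. lam w * ?p w) + (LBINT w:{u<..v}. lam w * ?p w)"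
        by (rule set_integral_Un)
          (use that a in \<open>auto intro!: integrable_times_prob_below lam_integrable\<close>)
      ultimately show ?thesis
        by (simp add: G_def)
    qed
    have "(\<Sum>i<Suc n. G (g n (Suc i)) - G (g n i)) = G t - G a" for n
      by (subst sum_lessThan_telescope) (simp add: g_0 g_end)
    moreover have "G a = 0"
      by (simp add: G_def set_lebesgue_integral_def)
    ultimately have G: "G t = (\<Sum>i<Suc n. G (g n (Suc i)) - G (g n i))" for n
      by simp
    have err: "G (g n (Suc i)) - G (g n i) \<le> (\<Lambda> (g n (Suc i)) - \<Lambda> (g n i)) * ?p (g n i)"
      "(\<Lambda> (g n (Suc i)) - \<Lambda> (g n i)) * ?p (g n i) - (G (g n (Suc i)) - G (g n i)) \<le>
        lam 0 * h n * (?p (g n i) - ?p (g n (Suc i)))" if "i < Suc n" for n i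
      using left_sum_error[of a "g n i" "g n (Suc i)" x] G_diff[of "g n i" "g n (Suc i)"] a
        g_bounds[of n i] g_bounds(2)[of "Suc i" n] g_mono[of i "Suc i" n] that
      by (auto simp: g_Suc)
    have lower: "G t \<le> expectation (Z n)" for n
      unfolding EZ G[of n] by (intro sum_mono err) auto
    \<comment> \<open>The cell errors share the factor \<open>lam 0 * h n\<close>, and the remaining
      differences telescope to \<open>?p a - ?p t\<close>, which is at most 1.\<close>
    have upper: "expectation (Z n) \<le> G t + lam 0 * h n" for n
    proof -
      have "expectation (Z n) - G t =
          (\<Sum>i<Suc n. (\<Lambda> (g n (Suc i)) - \<Lambda> (g n i)) * ?p (g n i) - (G (g n (Suc i)) - G (g n i)))"
        unfolding EZ G[of n] by (simp add: sum_subtractf)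
      also have "\<dots> \<le> (\<Sum>i<Suc n. lam 0 * h n * (?p (g n i) - ?p (g n (Suc i))))"
        by (intro sum_mono err) auto
      also have "\<dots> = lam 0 * h n * (?p a - ?p t)"
        unfolding sum_distrib_left[symmetric] by (subst sum_lessThan_telescope') (simp add: g_0 g_end)
      also have "\<dots> \<le> lam 0 * h n * 1"
        using prob_below_bounds(2)[of a x a] prob_below_bounds(1)[of a x t] h_nonneg[of n] lam_nonneg[of 0] a
        by (intro mult_left_mono) auto
      finally show ?thesis by simp
    qed
    have "(\<lambda>n. G t + lam 0 * h n) \<longlonglongrightarrow> G t"
      using tendsto_add[OF tendsto_const tendsto_mult_left[OF h_lim, of "lam 0"], of "G t"] by simp
    then have "(\<lambda>n. expectation (Z n)) \<longlonglongrightarrow> G t"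
      by (rule tendsto_sandwich[where f="\<lambda>_. G t", rotated 3])
        (simp_all add: lower upper)
    then show ?thesis
      by (simp add: G_def)
  qed
  ultimately show "expectation (\<lambda>\<omega>. real (N (min t (\<beta> \<omega>)) \<omega> - N a \<omega>)) = (LBINT u:{a<..t}. lam u * ?p u)"
    by (rule LIMSEQ_unique)
qed

section \<open>Campbell's formula\<close>

text \<open>By \<open>mean\<close>, the jump measure cut to \<open>(a, \<beta> \<omega>]\<close> has
  on half-lines the mean given by the density \<open>lam u * p u\<close> on \<open>(a, b]\<close>;
  the comparison of random measures extends this to \<open>f\<close>. The weight \<open>p\<close>
  will be 1 for all arrivals and \<open>prob_below\<close> for arrivals up to stockout.\<close>

lemma expectation_jump_integral:
  fixes f p :: "real \<Rightarrow> real"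
  assumes ab: "0 \<le> a" "a \<le> b" "b \<le> S"
    and \<beta>: "\<And>\<omega>. \<omega> \<in> space M \<Longrightarrow> \<beta> \<omega> \<in> {a..b}"
    and mean: "\<And>t. t \<in> {a..b} \<Longrightarrow> integrable M (\<lambda>\<omega>. real (N (min t (\<beta> \<omega>)) \<omega> - N a \<omega>))"
      "\<And>t. t \<in> {a..b} \<Longrightarrow> expectation (\<lambda>\<omega>. real (N (min t (\<beta> \<omega>)) \<omega> - N a \<omega>)) = (LBINT u:{a<..t}. lam u * p u)"
    and p_nonneg: "\<And>u. u \<in> {a<..b} \<Longrightarrow> 0 \<le> p u"
    and lam_p: "set_integrable lborel {a<..b} (\<lambda>u. lam u * p u)"
    and f_meas: "set_borel_measurable lborel {a<..b} f"
    and f_nonneg: "\<And>u. u \<in> {a<..b} \<Longrightarrow> 0 \<le> f u"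
    and f_int: "set_integrable lborel {a<..b} (\<lambda>u. f u * (lam u * p u))"
  shows "expectation (\<lambda>\<omega>. jump_integral S N \<omega> a (\<beta> \<omega>) f) = (LBINT u:{a<..b}. f u * (lam u * p u))"
proof -
  \<comment> \<open>The indicators produce Borel functions on the whole line, since \<open>f\<close>
    and \<open>lam u * p u\<close> are controlled on \<open>(a, b]\<close> only.\<close>
  define g where "g u = ennreal (indicator {a<..b} u * f u)" for u
  define w where "w u = ennreal (indicator {a<..b} u * (lam u * p u))" for u
  define \<mu> where "\<mu> = density lborel w"
  define K where "K \<omega> = density (jump_measure S N \<omega>) (indicator {a<..\<beta> \<omega>})" for \<omega>
  have sets_J[measurable_cong]: "sets (jump_measure S N \<omega>) = sets borel" for \<omega>
    by (simp add: jump_measure_def)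
  have f_borel[measurable]: "(\<lambda>u. indicator {a<..b} u * f u) \<in> borel_measurable borel"
    using f_meas by (simp add: set_borel_measurable_def)
  have w_borel: "(\<lambda>u. indicator {a<..b} u * (lam u * p u)) \<in> borel_measurable borel"
    using borel_measurable_integrable[OF lam_p[unfolded set_integrable_def]] by simp
  have [measurable]: "g \<in> borel_measurable borel" "w \<in> borel_measurable borel"
    using w_borel unfolding g_def w_def by measurable
  have lam_p_nonneg: "0 \<le> lam u * p u" if "u \<in> {a<..b}" for u
    using that ab by (intro mult_nonneg_nonneg lam_nonneg p_nonneg) auto
  have K_emeasure: "emeasure (K \<omega>) A = emeasure (jump_measure S N \<omega>) ({a<..\<beta> \<omega>} \<inter> A)" if "A \<in> sets borel" for \<omega> A
    using that by (simp add: K_def emeasure_restricted sets_J)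
  \<comment> \<open>Replacing \<open>t\<close> by \<open>min t b\<close> moves it into
    \<open>{a..b}\<close> when \<open>a \<le> t\<close>, so that \<open>mean\<close> applies; since
    \<open>\<beta> \<omega> \<le> b\<close>, the set is unchanged.\<close>
  have K_atMost: "emeasure (K \<omega>) {..t} =
      (if t < a then 0 else ennreal (real (N (min (min t b) (\<beta> \<omega>)) \<omega> - N a \<omega>)))" if \<omega>: "\<omega> \<in> space M" for \<omega> t
  proof -
    have "{a<..\<beta> \<omega>} \<inter> {..t} = (if t < a then {} else {a<..min (min t b) (\<beta> \<omega>)})"
      using \<beta>[OF \<omega>] by auto
    then show ?thesis
      using \<beta>[OF \<omega>] ab by (auto simp: K_emeasure emeasure_jump_measure[OF \<omega>])
  qed
  have \<mu>_atMost: "emeasure \<mu> {..t} = (if t < a then 0 else ennreal (LBINT u:{a<..min t b}. lam u * p u))" for t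
  proof -
    have "emeasure \<mu> {..t} = (\<integral>\<^sup>+u. ennreal (indicator {a<..min t b} u * (lam u * p u)) \<partial>lborel)"
      unfolding \<mu>_def by (subst emeasure_density) (auto intro!: nn_integral_cong simp: w_def indicator_def)
    also have "\<dots> = ennreal (LBINT u:{a<..min t b}. lam u * p u)"
      unfolding set_lebesgue_integral_def real_scaleR_def
    proof (rule nn_integral_eq_integral)
      have "set_integrable lborel {a<..min t b} (\<lambda>u. lam u * p u)"
        by (rule set_integrable_subset[OF lam_p]) auto
      then show "integrable lborel (\<lambda>u. indicator {a<..min t b} u * (lam u * p u))"
        by (simp add: set_integrable_def)
      show "AE u in lborel. 0 \<le> indicator {a<..min t b} u * (lam u * p u)"
        by (auto simp: indicator_def lam_p_nonneg)
    qed
    finally show ?thesis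
      using ab by (auto simp: set_lebesgue_integral_def)
  qed
  have K_fin: "finite_measure (K \<omega>)" if \<omega>: "\<omega> \<in> space M" for \<omega>
  proof
    have "space (K \<omega>) = UNIV"
      by (simp add: K_def jump_measure_def)
    then show "emeasure (K \<omega>) (space (K \<omega>)) \<noteq> \<infinity>"
      using \<beta>[OF \<omega>] ab by (simp add: K_emeasure emeasure_jump_measure[OF \<omega>])
  qed
  have \<mu>_fin: "finite_measure \<mu>"
  proof
    have "emeasure \<mu> (space \<mu>) = (\<integral>\<^sup>+u. ennreal (indicator {a<..b} u * (lam u * p u)) \<partial>lborel)"
      unfolding \<mu>_def by (subst emeasure_density) (auto intro!: nn_integral_cong simp: w_def)
    then show "emeasure \<mu> (space \<mu>) \<noteq> \<infinity>"
      using integrableD(2)[OF lam_p[unfolded set_integrable_def]] 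
      by (auto simp: indicator_def lam_p_nonneg intro!: nn_integral_cong cong: if_cong)
  qed
  have K_meas: "(\<lambda>\<omega>. emeasure (K \<omega>) {..t}) \<in> borel_measurable M" for t
  proof -
    have "(\<lambda>\<omega>. if t < a then 0 else ennreal (real (N (min (min t b) (\<beta> \<omega>)) \<omega> - N a \<omega>))) \<in> borel_measurable M"
      using mean(1)[of "min t b"] ab by (cases "t < a") auto
    then show ?thesis
      by (subst measurable_cong[OF K_atMost])
  qed
  have K_mean: "(\<integral>\<^sup>+\<omega>. emeasure (K \<omega>) {..t} \<partial>M) = emeasure \<mu> {..t}" for t
  proof -
    have "(\<integral>\<^sup>+\<omega>. emeasure (K \<omega>) {..t} \<partial>M) =
        (\<integral>\<^sup>+\<omega>. (if t < a then 0 else ennreal (real (N (min (min t b) (\<beta> \<omega>)) \<omega> - N a \<omega>))) \<partial>M)"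
      by (intro nn_integral_cong K_atMost)
    also have "\<dots> = emeasure \<mu> {..t}"
      using mean[of "min t b"] ab by (auto simp: \<mu>_atMost nn_integral_eq_integral)
    finally show ?thesis .
  qed
  have sets_K: "sets (K \<omega>) = sets borel" for \<omega>
    by (simp add: K_def sets_J)
  have sets_\<mu>: "sets \<mu> = sets borel"
    by (simp add: \<mu>_def)
  have g_borel: "g \<in> borel_measurable borel"
    by measurable
  note kernel = kernel_nn_integral[of M K \<mu>, OF sets_K K_fin sets_\<mu> \<mu>_fin K_meas K_mean g_borel]
  have path: "jump_integral S N \<omega> a (\<beta> \<omega>) f = enn2real (\<integral>\<^sup>+u. g u \<partial>K \<omega>)" if \<omega>: "\<omega> \<in> space M" for \<omega>
  proof -
    \<comment> \<open>As \<open>\<beta> \<omega> \<le> b\<close>, inserting the indicator of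
      \<open>(a, b]\<close> changes nothing and makes the integrand visibly Borel.\<close>
    have eq: "indicator {a<..\<beta> \<omega>} u * f u = indicator {a<..\<beta> \<omega>} u * (indicator {a<..b} u * f u)" for u
      using \<beta>[OF \<omega>] by (auto simp: indicator_def)
    have "jump_integral S N \<omega> a (\<beta> \<omega>) f = (\<integral>u. indicator {a<..\<beta> \<omega>} u * f u \<partial>jump_measure S N \<omega>)"
      by (simp add: jump_integral_def set_lebesgue_integral_def)
    also have "\<dots> = enn2real (\<integral>\<^sup>+u. ennreal (indicator {a<..\<beta> \<omega>} u * f u) \<partial>jump_measure S N \<omega>)"
    proof (rule integral_eq_nn_integral)
      show "(\<lambda>u. indicator {a<..\<beta> \<omega>} u * f u) \<in> borel_measurable (jump_measure S N \<omega>)"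
        unfolding eq by measurable
      show "AE u in jump_measure S N \<omega>. 0 \<le> indicator {a<..\<beta> \<omega>} u * f u"
        using \<beta>[OF \<omega>] f_nonneg by (auto simp: indicator_def)
    qed
    also have "(\<integral>\<^sup>+u. ennreal (indicator {a<..\<beta> \<omega>} u * f u) \<partial>jump_measure S N \<omega>) = (\<integral>\<^sup>+u. g u \<partial>K \<omega>)"
      unfolding K_def using \<beta>[OF \<omega>]
      by (subst nn_integral_density) (auto intro!: nn_integral_cong simp: g_def indicator_def)
    finally show ?thesis .
  qed
  have fw_nonneg: "0 \<le> f u * (lam u * p u)" if "u \<in> {a<..b}" for u
    using that by (intro mult_nonneg_nonneg f_nonneg lam_p_nonneg)
  have "(\<integral>\<^sup>+u. g u \<partial>\<mu>) = (\<integral>\<^sup>+u. ennreal (indicator {a<..b} u * (f u * (lam u * p u))) \<partial>lborel)"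
    unfolding \<mu>_def
    by (subst nn_integral_density)
      (auto intro!: nn_integral_cong simp: g_def w_def indicator_def ennreal_mult' f_nonneg lam_p_nonneg mult.commute)
  also have "\<dots> = ennreal (LBINT u:{a<..b}. f u * (lam u * p u))"
    unfolding set_lebesgue_integral_def real_scaleR_def
    by (rule nn_integral_eq_integral)
      (use f_int in \<open>auto simp: set_integrable_def indicator_def fw_nonneg\<close>)
  finally have total: "(\<integral>\<^sup>+\<omega>. \<integral>\<^sup>+u. g u \<partial>K \<omega> \<partial>M) = ennreal (LBINT u:{a<..b}. f u * (lam u * p u))"
    using kernel(2) by simp
  have "(\<integral>\<^sup>+\<omega>. \<integral>\<^sup>+u. g u \<partial>K \<omega> \<partial>M) \<noteq> \<infinity>"
    unfolding total by simp
  \<comment> \<open>\<open>enn2real\<close> sends infinity to 0, so almost sure finiteness of the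
    pathwise integral is what permits dropping \<open>enn2real\<close> under the mean.\<close>
  then have finite: "AE \<omega> in M. (\<integral>\<^sup>+u. g u \<partial>K \<omega>) \<noteq> \<infinity>"
    by (intro nn_integral_PInf_AE kernel)
  have "expectation (\<lambda>\<omega>. jump_integral S N \<omega> a (\<beta> \<omega>) f) = expectation (\<lambda>\<omega>. enn2real (\<integral>\<^sup>+u. g u \<partial>K \<omega>))"
    by (rule Bochner_Integration.integral_cong) (simp_all add: path)
  also have "\<dots> = enn2real (\<integral>\<^sup>+\<omega>. ennreal (enn2real (\<integral>\<^sup>+u. g u \<partial>K \<omega>)) \<partial>M)"
    using kernel(1) by (intro integral_eq_nn_integral) auto
  also have "(\<integral>\<^sup>+\<omega>. ennreal (enn2real (\<integral>\<^sup>+u. g u \<partial>K \<omega>)) \<partial>M) = (\<integral>\<^sup>+\<omega>. \<integral>\<^sup>+u. g u \<partial>K \<omega> \<partial>M)"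
    by (rule nn_integral_cong_AE) (use finite in \<open>auto simp: less_top\<close>)
  also have "enn2real \<dots> = (LBINT u:{a<..b}. f u * (lam u * p u))"
    unfolding total set_lebesgue_integral_def
    by (intro enn2real_ennreal integral_nonneg) (auto simp: indicator_def fw_nonneg)
  finally show ?thesis .
qed

section \<open>Expansion in Poisson weights\<close>

abbreviation poisson_weight :: "real \<Rightarrow> nat \<Rightarrow> real \<Rightarrow> real" where
  "poisson_weight a i u \<equiv> exp (- (\<Lambda> u - \<Lambda> a)) * (\<Lambda> u - \<Lambda> a) ^ i / fact i"

text \<open>The weight at \<open>i\<close> is the difference of \<open>prob_below\<close> at the
  levels \<open>Suc i\<close> and \<open>i\<close>, so integrability follows from that of the two
  products.\<close>

lemma integrable_times_poisson_weight:
  assumes f: "set_integrable lborel A f" and a: "0 \<le> a" and A: "A \<in> sets borel" "A \<subseteq> {a..S}"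
  shows "set_integrable lborel A (\<lambda>u. f u * poisson_weight a i u)"
proof -
  have "set_integrable lborel A (\<lambda>u. f u * prob_below a (Suc i) u - f u * prob_below a i u)"
    by (intro set_integral_diff integrable_times_prob_below assms)
  moreover have eq: "f u * prob_below a (Suc i) u - f u * prob_below a i u = f u * poisson_weight a i u" if "u \<in> A" for u
  proof -
    have "a \<le> u" "u \<le> S"
      using A that by auto
    then show ?thesis
      by (simp add: prob_below_eq a algebra_simps)
  qed
  moreover have "set_integrable lborel A (\<lambda>u. f u * prob_below a (Suc i) u - f u * prob_below a i u) =
      set_integrable lborel A (\<lambda>u. f u * poisson_weight a i u)"
    by (rule set_integrable_cong[OF refl refl eq])
  ultimately show ?thesis
    by blast
qed

lemma integral_times_prob_below:
  assumes f: "set_integrable lborel A f" and a: "0 \<le> a" and A: "A \<in> sets borel" "A \<subseteq> {a..S}"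
  shows "(LBINT u:A. f u * prob_below a x u) = (\<Sum>i<x. LBINT u:A. f u * poisson_weight a i u)"
proof -
  have "(LBINT u:A. f u * prob_below a x u) = (LBINT u:A. (\<Sum>i<x. f u * poisson_weight a i u))"
  proof (rule set_lebesgue_integral_cong)
    show "\<forall>u. u \<in> A \<longrightarrow> f u * prob_below a x u = (\<Sum>i<x. f u * poisson_weight a i u)"
    proof safe
      fix u assume "u \<in> A"
      then have "a \<le> u" "u \<le> S"
        using A by auto
      then show "f u * prob_below a x u = (\<Sum>i<x. f u * poisson_weight a i u)"
        by (simp add: prob_below_eq a sum_distrib_left)
    qed
  qed (use A in auto)
  also have "\<dots> = (\<Sum>i<x. LBINT u:A. f u * poisson_weight a i u)"
    unfolding set_lebesgue_integral_def scaleR_sum_right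
    by (intro Bochner_Integration.integral_sum)
      (use integrable_times_poisson_weight[OF assms] in \<open>simp add: set_integrable_def\<close>)
  finally show ?thesis .
qed

section \<open>Holding cost\<close>

text \<open>Right-continuity gives joint measurability: the process is the limit of processes that
  read the path at the next grid time to the right, and each of these uses countably many
  times.\<close>

lemma clamped_process_measurable:
  assumes S: "0 \<le> S"
  shows "(\<lambda>(\<omega>, u). N (max 0 (min S u)) \<omega>) \<in> measurable (M \<Otimes>\<^sub>M borel) (count_space UNIV)"
proof -
  \<comment> \<open>The smallest multiple of \<open>1 / real (Suc n)\<close> strictly above
    \<open>u\<close>; strictness matches the right neighbourhood on which the clamped path is
    constant.\<close>
  define q where "q n u = (of_int \<lfloor>u * real (Suc n)\<rfloor> + 1) / real (Suc n)" for n and u :: real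
  define X where "X n = (\<lambda>(\<omega>, u). real (N (max 0 (min S (q n u))) \<omega>))" for n
  have [measurable]: "N (max 0 (min S t)) \<in> measurable M (count_space UNIV)" for t
    using S by (intro measurable_N) auto
  have X_meas: "X n \<in> borel_measurable (M \<Otimes>\<^sub>M borel)" for n
  proof -
    have "(\<lambda>p. real (N (max 0 (min S ((of_int i + 1) / real (Suc n)))) (fst p))) \<in> borel_measurable (M \<Otimes>\<^sub>M borel)" for i :: int
      by measurable
    moreover have "(\<lambda>p. \<lfloor>snd p * real (Suc n)\<rfloor>) \<in> measurable (M \<Otimes>\<^sub>M borel) (count_space UNIV)"
      by measurable
    ultimately have "(\<lambda>p. real (N (max 0 (min S ((of_int \<lfloor>snd p * real (Suc n)\<rfloor> + 1) / real (Suc n)))) (fst p)))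
        \<in> borel_measurable (M \<Otimes>\<^sub>M borel)"
      by (rule measurable_compose_countable)
    then show ?thesis
      by (simp add: X_def q_def case_prod_beta)
  qed
  have q: "u < q n u" "q n u \<le> u + inverse (real (Suc n))" for n u
  proof -
    have "u * real (Suc n) < of_int \<lfloor>u * real (Suc n)\<rfloor> + 1" "of_int \<lfloor>u * real (Suc n)\<rfloor> \<le> u * real (Suc n)"
      by linarith+
    then show "u < q n u" "q n u \<le> u + inverse (real (Suc n))"
      by (simp_all add: q_def field_simps del: of_nat_Suc)
  qed
  have "(\<lambda>n. X n p) \<longlonglongrightarrow> (case p of (\<omega>, u) \<Rightarrow> real (N (max 0 (min S u)) \<omega>))"
    if "p \<in> space (M \<Otimes>\<^sub>M borel)" for p
  proof -
    obtain \<omega> u where p: "p = (\<omega>, u)" "\<omega> \<in> space M"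
      using \<open>p \<in> space (M \<Otimes>\<^sub>M borel)\<close> by (auto simp: space_pair_measure)
    obtain d where d: "u < d" "\<And>v. u < v \<Longrightarrow> v < d \<Longrightarrow> N (max 0 (min S v)) \<omega> = N (max 0 (min S u)) \<omega>"
      using clamped_locally_constant_right[OF p(2) S] by blast
    have "\<forall>\<^sub>F n in sequentially. inverse (real (Suc n)) < d - u"
      by (rule order_tendstoD[OF LIMSEQ_inverse_real_of_nat]) (use d in simp)
    then have "\<forall>\<^sub>F n in sequentially. X n p = real (N (max 0 (min S u)) \<omega>)"
    proof eventually_elim
      case (elim n)
      with q(1)[of u n] q(2)[of n u] d(2)[of "q n u"] show ?case
        by (simp add: X_def p)
    qed
    then show ?thesis
      by (simp add: p tendsto_eventually)
  qed
  then have "(\<lambda>(\<omega>, u). real (N (max 0 (min S u)) \<omega>)) \<in> borel_measurable (M \<Otimes>\<^sub>M borel)"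
    by (rule borel_measurable_LIMSEQ_real) (simp_all add: X_meas)
  \<comment> \<open>The limit is taken in the reals; rounding down recovers the natural number
    values.\<close>
  then have "(\<lambda>p. nat \<lfloor>case p of (\<omega>, u) \<Rightarrow> real (N (max 0 (min S u)) \<omega>)\<rfloor>) \<in> measurable (M \<Otimes>\<^sub>M borel) (count_space UNIV)"
    by measurable
  then show ?thesis
    by (simp add: case_prod_beta)
qed

lemma expected_shortfall:
  assumes "0 \<le> a" "a \<le> u" "u \<le> S"
  shows "expectation (\<lambda>\<omega>. max 0 (real x - (real (N u \<omega>) - real (N a \<omega>)))) = (\<Sum>n<x. prob_below a (Suc n) u)"
proof -
  have [measurable]: "(\<lambda>\<omega>. N u \<omega> - N a \<omega>) \<in> measurable M (count_space UNIV)"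
    using assms by (intro increment_measurable) auto
  have "max 0 (real x - (real (N u \<omega>) - real (N a \<omega>))) =
      (\<Sum>n<x. indicator {\<omega> \<in> space M. N u \<omega> - N a \<omega> < Suc n} \<omega>)" if "\<omega> \<in> space M" for \<omega>
  proof -
    have eq: "real (N u \<omega>) - real (N a \<omega>) = real (N u \<omega> - N a \<omega>)"
      using paths_mono[OF that, of a u] assms by simp
    show ?thesis
      unfolding eq stock_shortfall_eq_sum using that
      by (intro sum.cong refl) (simp add: indicator_def)
  qed
  then have "expectation (\<lambda>\<omega>. max 0 (real x - (real (N u \<omega>) - real (N a \<omega>)))) =
      expectation (\<lambda>\<omega>. \<Sum>n<x. indicator {\<omega> \<in> space M. N u \<omega> - N a \<omega> < Suc n} \<omega>)"
    by (intro Bochner_Integration.integral_cong refl)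
  also have "\<dots> = (\<Sum>n<x. expectation (indicator {\<omega> \<in> space M. N u \<omega> - N a \<omega> < Suc n}))"
    by (intro Bochner_Integration.integral_sum) (auto simp: less_top[symmetric])
  also have "\<dots> = (\<Sum>n<x. prob_below a (Suc n) u)"
    by (simp add: prob_below_def)
  finally show ?thesis .
qed

text \<open>Fubini exchanges expectation and time integral. At a fixed time the mean shortfall is a
  sum of \<open>prob_below\<close> over levels, and each summand expands in Poisson weights.\<close>

lemma expected_holding_cost:
  assumes ab: "0 \<le> a" "a \<le> b" "b \<le> S"
    and d[measurable]: "d \<in> borel_measurable borel" and d_bound: "\<And>u. u \<in> {a..b} \<Longrightarrow> \<bar>d u\<bar> \<le> B"
  shows "expectation (\<lambda>\<omega>. LBINT u:{a..b}. d u * max 0 (real x - (real (N u \<omega>) - real (N a \<omega>)))) =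
    (\<Sum>n<x. \<Sum>i\<le>n. LBINT u:{a..b}. d u * poisson_weight a i u)"
proof -
  interpret pair_sigma_finite M lborel ..
  \<comment> \<open>Clamping the time makes the integrand jointly measurable on the whole line and
    changes nothing on \<open>[a, b]\<close>.\<close>
  define F where "F \<omega> u = d u * max 0 (real x - (real (N (max 0 (min S u)) \<omega>) - real (N a \<omega>)))" for \<omega> u
  have [measurable]: "N a \<in> measurable M (count_space UNIV)"
    using ab by (intro measurable_N) auto
  have [measurable]: "(\<lambda>p. N (max 0 (min S (snd p))) (fst p)) \<in> measurable (M \<Otimes>\<^sub>M borel) (count_space UNIV)"
    using clamped_process_measurable ab by (simp add: case_prod_beta)
  have F_meas: "case_prod F \<in> borel_measurable (M \<Otimes>\<^sub>M borel)"
    unfolding F_def case_prod_beta by measurable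
  have "integrable (M \<Otimes>\<^sub>M lborel) (\<lambda>p. indicator (space M \<times> {a..b}) p *\<^sub>R case_prod F p)"
  proof (rule integrableI_bounded_set_indicator)
    show "space M \<times> {a..b} \<in> sets (M \<Otimes>\<^sub>M lborel)"
      by simp
    show "case_prod F \<in> borel_measurable (M \<Otimes>\<^sub>M lborel)"
      using F_meas by (simp cong: measurable_cong_sets)
    show "emeasure (M \<Otimes>\<^sub>M lborel) (space M \<times> {a..b}) < \<infinity>"
      using ab by (simp add: lborel.emeasure_pair_measure_Times emeasure_space_1)
    \<comment> \<open>Paths do not decrease, so the shortfall lies between 0 and \<open>x\<close>; a
      bounded integrand on a set of finite measure is integrable.\<close>
    have "norm (F \<omega> u) \<le> B * real x" if "\<omega> \<in> space M" "u \<in> {a..b}" for \<omega> u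
    proof -
      have "N a \<omega> \<le> N u \<omega>"
        using paths_mono[OF that(1), of a u] that ab by auto
      then have "\<bar>max 0 (real x - (real (N (max 0 (min S u)) \<omega>) - real (N a \<omega>)))\<bar> \<le> real x"
        using that ab by (auto simp: max_def)
      then show ?thesis
        unfolding F_def real_norm_def abs_mult using d_bound[OF that(2)] by (intro mult_mono) auto
    qed
    then show "AE p in M \<Otimes>\<^sub>M lborel. p \<in> space M \<times> {a..b} \<longrightarrow> norm (case_prod F p) \<le> B * real x"
      by auto
  qed
  then have int: "integrable (M \<Otimes>\<^sub>M lborel) (\<lambda>(\<omega>, u). indicator {a..b} u * F \<omega> u)"
    by (rule Bochner_Integration.integrable_cong[THEN iffD1, rotated 2])
      (auto simp: space_pair_measure indicator_def)
  have d_int: "set_integrable lborel {a..b} d"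
    unfolding set_integrable_def
    by (rule integrableI_bounded_set_indicator[where B=B]) (use ab d_bound in auto)
  have sub: "{a..b} \<subseteq> {a..S}" "{a..b} \<in> sets borel"
    using ab by auto
  have "expectation (\<lambda>\<omega>. LBINT u:{a..b}. d u * max 0 (real x - (real (N u \<omega>) - real (N a \<omega>)))) =
      expectation (\<lambda>\<omega>. \<integral>u. indicator {a..b} u * F \<omega> u \<partial>lborel)"
    unfolding set_lebesgue_integral_def
    by (intro Bochner_Integration.integral_cong refl) (use ab in \<open>auto simp: F_def indicator_def\<close>)
  also have "\<dots> = (\<integral>u. expectation (\<lambda>\<omega>. indicator {a..b} u * F \<omega> u) \<partial>lborel)"
    by (rule Fubini_integral[symmetric, OF int])
  also have "\<dots> = (LBINT u:{a..b}. (\<Sum>n<x. d u * prob_below a (Suc n) u))"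
    unfolding set_lebesgue_integral_def
    using ab by (intro Bochner_Integration.integral_cong refl)
      (auto simp: F_def indicator_def expected_shortfall sum_distrib_left)
  also have "\<dots> = (\<Sum>n<x. LBINT u:{a..b}. d u * prob_below a (Suc n) u)"
    unfolding set_lebesgue_integral_def scaleR_sum_right
    by (intro Bochner_Integration.integral_sum)
      (use integrable_times_prob_below[OF d_int ab(1) sub(2,1)] in \<open>simp add: set_integrable_def\<close>)
  also have "\<dots> = (\<Sum>n<x. \<Sum>i\<le>n. LBINT u:{a..b}. d u * poisson_weight a i u)"
    by (simp only: integral_times_prob_below[OF d_int ab(1) sub(2,1)] lessThan_Suc_atMost)
  finally show ?thesis .
qed

section \<open>Stockout time\<close>

text \<open>These are the cut-off properties under which the mean of the stopped increment was
  computed. They follow from the infimum together with monotonicity of the paths.\<close>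

lemma stockout_time_cutoff:
  fixes k x :: nat
  assumes \<omega>: "\<omega> \<in> space M" and kS: "real k + 1 \<le> S"
  defines "\<beta> \<equiv> real_of_ereal (min (ereal (real k + 1)) (stockout_time S N \<omega> k x))"
  shows "\<beta> \<in> {real k..real k + 1}"
    and "real k \<le> u \<Longrightarrow> u < \<beta> \<Longrightarrow> N u \<omega> - N (real k) \<omega> < x"
    and "\<beta> < u \<Longrightarrow> u \<le> real k + 1 \<Longrightarrow> x \<le> N u \<omega> - N (real k) \<omega>"
proof -
  define A where "A = {u. real k < u \<and> u \<le> S \<and> x \<le> N u \<omega> - N (real k) \<omega>}"
  have \<sigma>: "stockout_time S N \<omega> k x = Inf (ereal ` A)"
    by (simp add: stockout_time_def A_def)
  have "ereal (real k) \<le> Inf (ereal ` A)"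
    by (rule Inf_greatest) (auto simp: A_def)
  then have "ereal (real k) \<le> min (ereal (real k + 1)) (Inf (ereal ` A))"
    by simp
  \<comment> \<open>The minimum lies between \<open>k\<close> and \<open>k + 1\<close>, so the
    conversion to a real loses nothing, even when the stockout time is infinite.\<close>
  then have \<beta>: "ereal \<beta> = min (ereal (real k + 1)) (Inf (ereal ` A))"
    unfolding \<beta>_def \<sigma>
    by (intro ereal_real') (auto simp: min_def)
  then have "ereal (real k) \<le> ereal \<beta>" "ereal \<beta> \<le> ereal (real k + 1)"
    using \<open>ereal (real k) \<le> Inf (ereal ` A)\<close> by simp_all
  then show bounds: "\<beta> \<in> {real k..real k + 1}"
    by simp
  have not_in: "v \<notin> A" if "v < \<beta>" for v
  proof
    assume "v \<in> A"
    then have "ereal \<beta> \<le> ereal v"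
      unfolding \<beta> by (intro min.coboundedI2 Inf_lower) simp
    with that show False by simp
  qed
  show "N u \<omega> - N (real k) \<omega> < x" if u: "real k \<le> u" "u < \<beta>"
  proof (rule ccontr)
    assume "\<not> N u \<omega> - N (real k) \<omega> < x"
    \<comment> \<open>Membership in \<open>A\<close> requires a time strictly after
      \<open>k\<close>, while \<open>u = k\<close> is allowed; the midpoint of \<open>u\<close> and
      \<open>\<beta>\<close> is strictly after \<open>k\<close> and still before
      \<open>\<beta>\<close>.\<close>
    moreover have "N u \<omega> \<le> N ((u + \<beta>) / 2) \<omega>"
      using u bounds kS by (intro paths_mono[OF \<omega>]) auto
    ultimately have "(u + \<beta>) / 2 \<in> A"
      using u bounds kS by (auto simp: A_def)
    with not_in[of "(u + \<beta>) / 2"] u show False by simp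
  qed
  show "x \<le> N u \<omega> - N (real k) \<omega>" if u: "\<beta> < u" "u \<le> real k + 1"
  proof -
    have "ereal \<beta> < ereal (real k + 1)" "ereal \<beta> < ereal u"
      using u by simp_all
    \<comment> \<open>Since \<open>\<beta> < k + 1\<close>, the minimum is the infimum itself, so
      some element of \<open>A\<close> lies below \<open>u\<close>.\<close>
    then have "Inf (ereal ` A) < ereal u"
      unfolding \<beta> by (auto simp: min_less_iff_disj)
    then obtain v where "v \<in> A" "v < u"
      by (auto simp: Inf_less_iff)
    then show ?thesis
      using paths_mono[OF \<omega>, of v u] u kS by (auto simp: A_def intro: order_trans diff_le_mono)
  qed
qed

section \<open>Assembly of the operation cost\<close>

text \<open>Holding cost, arrivals and sales are computed separately. The formula is uniform in
  \<open>x\<close>: at \<open>x = 0\<close> the sums over levels and weights are empty.\<close>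

lemma operation_cost_eq:
  fixes k :: nat and c2 c3 :: "real \<Rightarrow> real"
  assumes kS: "real k + 1 \<le> S" and \<delta>: "0 \<le> \<delta>"
    and c3_nonneg: "\<And>u. u \<in> {0..S} \<Longrightarrow> 0 \<le> c3 u"
    and c2_ge_c3: "\<And>u. u \<in> {0..S} \<Longrightarrow> c3 u \<le> c2 u"
    and c2_meas: "c2 \<in> borel_measurable (restrict_space borel {0..S})"
    and c3_meas: "c3 \<in> borel_measurable (restrict_space borel {0..S})"
    and c2_int: "set_integrable lborel {0..S} (\<lambda>u. c2 u * lam u)"
  defines "d \<equiv> \<lambda>u. exp (- \<delta> * (u - real k))"
  shows "operation_cost M S N c1 \<delta> c2 c3 k x =
      c1 * (\<Sum>n<x. \<Sum>i\<le>n. LBINT u:{real k..real k + 1}. d u * poisson_weight (real k) i u)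
    + (LBINT u:{real k..real k + 1}. d u * (c2 u - c3 u) * lam u)
    - (\<Sum>i<x. LBINT u:{real k..real k + 1}. d u * c2 u * lam u * poisson_weight (real k) i u)"
proof -
  define a where "a = real k"
  define b where "b = real k + 1"
  define \<beta> where "\<beta> \<omega> = real_of_ereal (min (ereal b) (stockout_time S N \<omega> k x))" for \<omega>
  have ab: "0 \<le> a" "a \<le> b" "b \<le> S"
    using kS by (auto simp: a_def b_def)
  have sub: "{a<..b} \<subseteq> {0..S}" "{a<..b} \<subseteq> {a..S}"
    using ab by auto
  have d_borel[measurable]: "d \<in> borel_measurable borel"
    unfolding d_def by measurable
  have d_set: "set_borel_measurable lborel {a<..b} d"
    unfolding set_borel_measurable_def by measurable
  have d_bounds: "0 \<le> d u" "d u \<le> 1" if "u \<in> {a..b}" for u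
    using that \<delta> by (auto simp: d_def a_def mult_nonpos_nonneg)
  have c2_set: "set_borel_measurable lborel {a<..b} c2"
    by (rule set_borel_measurable_of_restrict_space[OF c2_meas]) (use sub in auto)
  have c23_set: "set_borel_measurable lborel {a<..b} (\<lambda>u. c2 u - c3 u)"
    by (rule set_borel_measurable_of_restrict_space) (use sub c2_meas c3_meas in auto)
  have lam_int: "set_integrable lborel {a<..b} lam"
    by (rule lam_integrable) (use sub in auto)
  have lam_set: "set_borel_measurable lborel {a<..b} lam"
    by (rule set_borel_measurable_of_restrict_space[OF lam_measurable]) (use sub in auto)
  have c2_lam: "set_integrable lborel {a<..b} (\<lambda>u. c2 u * lam u)"
    by (rule set_integrable_subset[OF c2_int]) (use sub in auto)
  \<comment> \<open>The discount factor is at most 1 and both \<open>c2\<close> and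
    \<open>c2 - c3\<close> lie between 0 and \<open>c2\<close>, so \<open>c2 u * lam u\<close>
    dominates every discounted integrand.\<close>
  have discounted_int: "set_integrable lborel {a<..b} (\<lambda>u. d u * g u * lam u)"
    if g: "set_borel_measurable lborel {a<..b} g" and g_le: "\<And>u. u \<in> {a<..b} \<Longrightarrow> 0 \<le> g u \<and> g u \<le> c2 u" for g
  proof (rule set_integrable_bound[OF c2_lam])
    show "set_borel_measurable lborel {a<..b} (\<lambda>u. d u * g u * lam u)"
      by (intro set_borel_measurable_mult d_set g lam_set)
    have "norm (d u * g u * lam u) \<le> norm (c2 u * lam u)" if u: "u \<in> {a<..b}" for u
    proof -
      have "0 \<le> lam u"
        using sub u by (intro lam_nonneg) auto
      moreover have "d u * g u \<le> 1 * c2 u"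
        using d_bounds[of u] g_le[OF u] u by (intro mult_mono) auto
      ultimately show ?thesis
        using d_bounds[of u] g_le[OF u] u by (simp add: abs_mult mult_right_mono)
    qed
    then show "AE u in lborel. u \<in> {a<..b} \<longrightarrow> norm (d u * g u * lam u) \<le> norm (c2 u * lam u)"
      by auto
  qed
  have c_bounds: "0 \<le> c2 u \<and> c2 u \<le> c2 u" "0 \<le> c2 u - c3 u \<and> c2 u - c3 u \<le> c2 u" if "u \<in> {a<..b}" for u
  proof -
    have "u \<in> {0..S}"
      using that sub by auto
    from c3_nonneg[OF this] c2_ge_c3[OF this]
    show "0 \<le> c2 u \<and> c2 u \<le> c2 u" "0 \<le> c2 u - c3 u \<and> c2 u - c3 u \<le> c2 u"
      by auto
  qed
  note int_c2 = discounted_int[OF c2_set c_bounds(1)]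
  note int_c23 = discounted_int[OF c23_set c_bounds(2)]

  have holding: "expectation (\<lambda>\<omega>. LBINT u:{a..b}. d u * max 0 (real x - (real (N u \<omega>) - real (N a \<omega>)))) =
      (\<Sum>n<x. \<Sum>i\<le>n. LBINT u:{a..b}. d u * poisson_weight a i u)"
    by (rule expected_holding_cost[where B=1, OF ab d_borel]) (use d_bounds in auto)

  \<comment> \<open>The cut-off is the constant \<open>b\<close> and the weight is 1, so the
    required mean is an increment of \<open>\<Lambda>\<close>.\<close>
  have arrivals: "expectation (\<lambda>\<omega>. jump_integral S N \<omega> a b (\<lambda>u. d u * (c2 u - c3 u))) =
      (LBINT u:{a<..b}. d u * (c2 u - c3 u) * (lam u * 1))"
  proof (rule expectation_jump_integral[OF ab, where \<beta>="\<lambda>_. b"])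
    fix t assume t: "t \<in> {a..b}"
    then have "min t b = t" by simp
    with t ab show "integrable M (\<lambda>\<omega>. real (N (min t b) \<omega> - N a \<omega>))"
      "expectation (\<lambda>\<omega>. real (N (min t b) \<omega> - N a \<omega>)) = (LBINT u:{a<..t}. lam u * 1)"
      using increment_mean[of a t] \<Lambda>_diff[of a t] by auto
  next
    show "set_integrable lborel {a<..b} (\<lambda>u. d u * (c2 u - c3 u) * (lam u * 1))"
      using int_c23 by simp
    show "set_borel_measurable lborel {a<..b} (\<lambda>u. d u * (c2 u - c3 u))"
      by (rule set_borel_measurable_mult[OF d_set c23_set])
  qed (use ab lam_int d_bounds c_bounds in auto)

  \<comment> \<open>The cut-off is now \<open>\<beta>\<close>, and the weight is the probability of
    fewer than \<open>x\<close> arrivals by time \<open>u\<close>.\<close>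
  have sales: "expectation (\<lambda>\<omega>. jump_integral S N \<omega> a (\<beta> \<omega>) (\<lambda>u. d u * c2 u)) =
      (LBINT u:{a<..b}. d u * c2 u * (lam u * prob_below a x u))"
  proof (rule expectation_jump_integral[OF ab])
    note cutoff = stockout_time_cutoff[where x=x, OF _ kS, folded a_def b_def, folded \<beta>_def]
    show "\<beta> \<omega> \<in> {a..b}" if "\<omega> \<in> space M" for \<omega>
      using cutoff(1)[OF that] .
    fix t assume t: "t \<in> {a..b}"
    show "integrable M (\<lambda>\<omega>. real (N (min t (\<beta> \<omega>)) \<omega> - N a \<omega>))"
      "expectation (\<lambda>\<omega>. real (N (min t (\<beta> \<omega>)) \<omega> - N a \<omega>)) = (LBINT u:{a<..t}. lam u * prob_below a x u)"
      using stopped_increment_mean[of a t b \<beta> x] cutoff t ab by auto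
  next
    show "set_integrable lborel {a<..b} (\<lambda>u. lam u * prob_below a x u)"
      by (rule integrable_times_prob_below[OF lam_int ab(1) _ sub(2)]) simp
    show "set_borel_measurable lborel {a<..b} (\<lambda>u. d u * c2 u)"
      by (rule set_borel_measurable_mult[OF d_set c2_set])
    show "set_integrable lborel {a<..b} (\<lambda>u. d u * c2 u * (lam u * prob_below a x u))"
      using integrable_times_prob_below[OF int_c2 ab(1) _ sub(2), of x] by (simp add: mult.assoc)
  qed (use d_bounds c_bounds in \<open>auto simp: prob_below_bounds\<close>)
  also have "\<dots> = (LBINT u:{a<..b}. d u * c2 u * lam u * prob_below a x u)"
    by (simp add: mult.assoc)
  also have "\<dots> = (\<Sum>i<x. LBINT u:{a<..b}. d u * c2 u * lam u * poisson_weight a i u)"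
    by (rule integral_times_prob_below[OF int_c2 ab(1) _ sub(2)]) auto
  finally show ?thesis
    using holding arrivals
    unfolding operation_cost_def \<beta>_def a_def b_def d_def LBINT_Ioc_eq_Icc by simp
qed

end

text \<open>The horizon \<open>T + 1\<close> accommodates the period that starts at the last epoch.
  Measurability of the costs and integrability of \<open>c2 u * lam u\<close> make the cost
  integrals finite. The last sum ends at \<open>x - 1\<close>, not at \<open>x\<close>: a jump at
  \<open>u\<close> is served iff fewer than \<open>x\<close> arrivals precede it.\<close>

theorem proposition3p3:
  fixes M :: "'a measure" and N :: "real \<Rightarrow> 'a \<Rightarrow> nat"
    and T c1 \<delta> :: real and lam c2 c3 :: "real \<Rightarrow> real" and k :: nat
  assumes horizon: "0 \<le> T"
    and intensity: "intensity_function (T + 1) lam"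
    and poisson: "nonhomogeneous_poisson_process M (T + 1) lam N"
    and c1: "0 \<le> c1"
    and \<delta>: "0 \<le> \<delta>" "\<delta> \<le> 1"
    and c3_nonneg: "\<And>u. u \<in> {0..T + 1} \<Longrightarrow> 0 \<le> c3 u"
    and c2_ge_c3: "\<And>u. u \<in> {0..T + 1} \<Longrightarrow> c3 u \<le> c2 u"
    and measurable_c2: "c2 \<in> borel_measurable (restrict_space borel {0..T + 1})"
    and measurable_c3: "c3 \<in> borel_measurable (restrict_space borel {0..T + 1})"
    and integrable_c2: "set_integrable lborel {0..T + 1} (\<lambda>u. c2 u * lam u)"
    and k: "real k \<le> T"
  shows "operation_cost M (T + 1) N c1 \<delta> c2 c3 k 0 =
           (LBINT u:{real k..real k + 1}. exp (- \<delta> * (u - real k)) * (c2 u - c3 u) * lam u) \<and>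
         (\<forall>x\<ge>1. operation_cost M (T + 1) N c1 \<delta> c2 c3 k x =
           c1 * (\<Sum>n=0..x - 1. \<Sum>i=0..n. (LBINT u:{real k..real k + 1}.
                   exp (- \<delta> * (u - real k)) * exp (- (cumulative_intensity lam u - cumulative_intensity lam (real k))) *
                   (cumulative_intensity lam u - cumulative_intensity lam (real k)) ^ i / fact i))
         + (LBINT u:{real k..real k + 1}. exp (- \<delta> * (u - real k)) * (c2 u - c3 u) * lam u)
         - (\<Sum>i=0..x - 1. (LBINT u:{real k..real k + 1}.
              exp (- \<delta> * (u - real k)) * c2 u * lam u * exp (- (cumulative_intensity lam u - cumulative_intensity lam (real k))) *
              (cumulative_intensity lam u - cumulative_intensity lam (real k)) ^ i / fact i)))"
proof -
  interpret intensity_poisson_process M "T + 1" lam N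
    using intensity poisson by (simp add: intensity_poisson_process_def intensity_poisson_process_axioms_def)
  have cost: "operation_cost M (T + 1) N c1 \<delta> c2 c3 k x =
      c1 * (\<Sum>n<x. \<Sum>i\<le>n. LBINT u:{real k..real k + 1}. exp (- \<delta> * (u - real k)) * poisson_weight (real k) i u)
    + (LBINT u:{real k..real k + 1}. exp (- \<delta> * (u - real k)) * (c2 u - c3 u) * lam u)
    - (\<Sum>i<x. LBINT u:{real k..real k + 1}. exp (- \<delta> * (u - real k)) * c2 u * lam u * poisson_weight (real k) i u)" for x
    by (rule operation_cost_eq)
      (use k \<delta> c3_nonneg c2_ge_c3 measurable_c2 measurable_c3 integrable_c2 in auto)
  \<comment> \<open>The condition \<open>1 \<le> x\<close> matters: at \<open>x = 0\<close> the
    truncated \<open>x - 1\<close> would give the index set \<open>{0}\<close> instead of the empty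
    one.\<close>
  have index: "{..<x} = {0..x - 1}" if "1 \<le> x" for x :: nat
    using that by auto
  show ?thesis
    by (intro conjI allI impI; subst cost) (simp_all add: index atMost_atLeast0 mult.assoc)
qed

end
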